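(* Let $N\in\{1,2,3\}$, let $n\in\mathbb{N}$, and let $B=(\beta_{ij})_{ij}\in S(n)$ be a symmetric real $n\times n$ matrix with $\beta_{ii}\ge 0$ for $i=1,\dots,n$. If $B$ is not strictly copositive, then the system $$-\Delta u_i=\sum_{j=1}^n\beta_{ij}u_j^2u_i,\qquad u_1,\dots,u_n\ge 0\qquad\text{in }\mathbb{R}^N\qquad(i=1,\dots,n)$$ admits a nontrivial solution $u=(u_1,\dots,u_n)$.
   Context: $S(n)$ denotes the space of symmetric $n\times n$ matrices with real coefficients, and $C^n_+=\{c\in\mathbb{R}^n: c_i\ge 0 \text{ for all } i\}$. A matrix $B=(\beta_{ij})_{ij}\in S(n)$ is strictly copositive if $\sum_{i,j=1}^n\beta_{ij}c_ic_j>0$ for all $c\in C^n_+\setminus\{0\}$. A solution $u=(u_1,\dots,u_n)$ of the system (all components nonnegative) is called nontrivial if $u_i\not\equiv 0$ for at least one $i$. *)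

theory Defs
  imports "HOL-Analysis.Analysis"
begin

definition nonneg_cone :: "(real ^ 'n) set" where
  "nonneg_cone = {c. \<forall>i. c $ i \<ge> 0}"

definition strictly_copositive :: "real ^ 'n ^ 'n \<Rightarrow> bool" where
  "strictly_copositive B \<longleftrightarrow>
     (\<forall>c \<in> nonneg_cone - {0}. (\<Sum>i\<in>UNIV. \<Sum>j\<in>UNIV. B $ i $ j * c $ i * c $ j) > 0)"

(* The value is meaningful only where f is differentiable. *)
definition partial_deriv :: "'d \<Rightarrow> (real ^ 'd \<Rightarrow> real) \<Rightarrow> real ^ 'd \<Rightarrow> real" where
  "partial_deriv k f x = frechet_derivative f (at x) (axis k 1)"

(* The class C^2(R^N).  Continuity of f and of its first partial derivatives
   follows from their differentiability. *)
definition C2 :: "(real ^ 'd \<Rightarrow> real) \<Rightarrow> bool" where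
  "C2 f \<longleftrightarrow>
     f differentiable_on UNIV \<and>
     (\<forall>k. partial_deriv k f differentiable_on UNIV) \<and>
     (\<forall>k l. continuous_on UNIV (partial_deriv l (partial_deriv k f)))"

definition laplacian :: "(real ^ 'd \<Rightarrow> real) \<Rightarrow> real ^ 'd \<Rightarrow> real" where
  "laplacian f x = (\<Sum>k\<in>UNIV. partial_deriv k (partial_deriv k f) x)"

(* Solutions are understood in the classical sense on the whole space. *)
definition is_solution :: "real ^ 'n ^ 'n \<Rightarrow> ('n \<Rightarrow> real ^ 'd \<Rightarrow> real) \<Rightarrow> bool" where
  "is_solution B u \<longleftrightarrow>
     (\<forall>i. C2 (u i)) \<and>
     (\<forall>i x. u i x \<ge> 0) \<and>
     (\<forall>i x. - laplacian (u i) x = (\<Sum>j\<in>UNIV. B $ i $ j * (u j x)\<^sup>2 * u i x))"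

definition nontrivial :: "('n \<Rightarrow> real ^ 'd \<Rightarrow> real) \<Rightarrow> bool" where
  "nontrivial u \<longleftrightarrow> (\<exists>i. u i \<noteq> (\<lambda>x. 0))"

end

theory Submission
  imports Defs "HOL-Complex_Analysis.Great_Picard"
begin

text \<open>
  The solution is sought among functions of one coordinate, which turns the problem into the system
  \<open>- V\<^sub>i'' = \<Sum>\<^sub>j b i j * V\<^sub>j\<^sup>2 * V\<^sub>i\<close> on the line (\<open>solution_of_line_solution\<close>).  Restrict it to a minimal set
  \<open>I\<close> of indices on which the quadratic form \<open>q\<close> of the matrix is not strictly copositive.  If
  \<open>q \<ge> 0\<close> on the nonnegative cone over \<open>I\<close>, then \<open>q\<close> vanishes at a point \<open>c\<close> in the interior of this cone, together with
  its gradient, and the constants \<open>sqrt (c i)\<close> are a solution.  Otherwise \<open>q (c) < 0\<close> for some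
  \<open>c\<close> with positive entries, while \<open>q > 0\<close> on all proper faces of the cone
  (\<open>critical_matrix_or_null_vector\<close>).

  In this case a solution of period 1 comes from a min-max problem for the action
  \<open>J (v) = 1/2 \<Sum> \<integral> v\<^sub>i'\<^sup>2 - 1/4 \<integral> q (v\<^sup>2)\<close>.  For a profile \<open>u\<close> with \<open>\<integral> u\<^sub>i\<^sup>4 = 1\<close> take the supremum of
  \<open>J\<close> over its fibre, the functions \<open>(sqrt (t i) * u\<^sub>i)\<^sub>i\<close> with \<open>t \<ge> 0\<close>, and minimise this value over
  \<open>u\<close>.  The value is finite for components with disjoint supports because \<open>b i i > 0\<close>
  (\<open>admissible_exists\<close>), and infinite for constants because \<open>q (c) < 0\<close> (\<open>positive_energy\<close>): the
  minimiser is not constant.  A bound on the value bounds the energies of all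
  components, so a minimiser exists by compactness (\<open>minimiser_exists\<close>).

  The supremum over the fibre is attained at a single point \<open>s\<close>.  The reason is that
  minimality of \<open>I\<close> forces \<open>q > 0\<close> at every nonzero vector with entries of both signs
  (\<open>mixed_sign_pos\<close>); integrating over \<open>x\<close>, the form \<open>t \<mapsto> \<integral> q (t u\<^sup>2)\<close> is
  positive definite whenever the value of \<open>u\<close> is finite (\<open>interaction_posdef\<close>), so that \<open>J\<close> is strictly
  concave in \<open>t\<close>.  With a unique maximiser the min-max value can be differentiated under the
  maximum (\<open>first_variation\<close>), and minimality of \<open>u\<close> says that \<open>(sqrt (s i) * u\<^sub>i)\<^sub>i\<close> is a critical point of \<open>J\<close>, that is,
  a solution.

  The energy \<open>\<integral> u'\<^sup>2\<close> is measured through the values of \<open>u\<close> on dyadic grids, and the equation is tested against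
  piecewise linear hats with dyadic kinks.  Their inner product with \<open>u\<close> is a second
  difference of \<open>u\<close>, from which a twice differentiable solution is recovered by
  comparison with a second antiderivative (\<open>weak_solution_classical\<close>).
\<close>

section \<open>Quadratic forms on the faces of the nonnegative cone\<close>

definition qf :: "('n \<Rightarrow> 'n \<Rightarrow> real) \<Rightarrow> 'n set \<Rightarrow> ('n \<Rightarrow> real) \<Rightarrow> real" where
  "qf M I w = (\<Sum>i\<in>I. \<Sum>j\<in>I. M i j * w i * w j)"

lemma qf_scale: "qf M I (\<lambda>i. s * w i) = s\<^sup>2 * qf M I w"
  unfolding qf_def by (simp add: sum_distrib_left power2_eq_square mult_ac)

lemma qf_add:
  assumes "\<And>i j. M i j = M j i"
  shows "qf M I (\<lambda>i. v i + s * w i)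
    = qf M I v + 2 * s * (\<Sum>i\<in>I. w i * (\<Sum>j\<in>I. M i j * v j)) + s\<^sup>2 * qf M I w"
proof -
  have swap: "(\<Sum>i\<in>I. \<Sum>j\<in>I. M i j * v i * w j) = (\<Sum>i\<in>I. \<Sum>j\<in>I. M i j * w i * v j)"
    using assms by (subst sum.swap) (auto intro!: sum.cong simp: mult_ac)
  have "qf M I (\<lambda>i. v i + s * w i) = qf M I v + s * (\<Sum>i\<in>I. \<Sum>j\<in>I. M i j * v i * w j)
     + s * (\<Sum>i\<in>I. \<Sum>j\<in>I. M i j * w i * v j) + s\<^sup>2 * qf M I w"
    unfolding qf_def
    by (simp add: sum_distrib_left sum.distrib[symmetric] power2_eq_square algebra_simps)
  also have "\<dots> = qf M I v + 2 * s * (\<Sum>i\<in>I. \<Sum>j\<in>I. M i j * w i * v j) + s\<^sup>2 * qf M I w"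
    using swap by simp
  also have "(\<Sum>i\<in>I. \<Sum>j\<in>I. M i j * w i * v j) = (\<Sum>i\<in>I. w i * (\<Sum>j\<in>I. M i j * v j))"
    by (simp add: sum_distrib_left mult_ac)
  finally show ?thesis .
qed

lemma qf_cong: "(\<And>i. i \<in> I \<Longrightarrow> v i = w i) \<Longrightarrow> qf M I v = qf M I w"
  unfolding qf_def by (auto intro!: sum.cong)

lemma qf_uminus: "qf M I (\<lambda>i. - w i) = qf M I w"
  using qf_scale[of M I "-1" w] by simp

lemma qf_eq_0: "(\<And>i. i \<in> I \<Longrightarrow> w i = 0) \<Longrightarrow> qf M I w = 0"
  unfolding qf_def by simp

lemma qf_delta:
  assumes "finite I" "i \<in> I"
  shows "qf M I (\<lambda>k. if k = i then s else 0) = s\<^sup>2 * M i i"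
  unfolding qf_def using assms by (simp add: if_distrib[of "\<lambda>x. _ * x"] if_distrib[of "\<lambda>x. x * _"]
     sum.delta power2_eq_square cong: if_cong)

lemma qf_sub_matrix: "qf (\<lambda>i j. M i j + e * N i j) I w = qf M I w + e * qf N I w"
  unfolding qf_def by (simp add: sum_distrib_left sum.distrib[symmetric] algebra_simps)

lemma tendsto_qf:
  assumes "finite I" "\<And>i j. i \<in> I \<Longrightarrow> j \<in> I \<Longrightarrow> ((\<lambda>k. M k i j) \<longlongrightarrow> N i j) F"
    "\<And>i. i \<in> I \<Longrightarrow> ((\<lambda>k. w k i) \<longlongrightarrow> v i) F"
  shows "((\<lambda>k. qf (M k) I (w k)) \<longlongrightarrow> qf N I v) F"
  unfolding qf_def by (intro tendsto_intros assms)

text \<open>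
  A symmetric matrix whose quadratic form is negative somewhere on the nonnegative cone over \<open>I\<close>
  but positive on every proper face.  Such matrices arise on minimal sets of indices on which strict
  copositivity fails.
\<close>

locale critical_matrix =
  fixes b :: "'n::finite \<Rightarrow> 'n \<Rightarrow> real" and I :: "'n set" and c :: "'n \<Rightarrow> real"
  assumes sym: "b i j = b j i"
    and face_pos: "(\<And>i. i \<in> I \<Longrightarrow> w i \<ge> 0) \<Longrightarrow> i \<in> I \<Longrightarrow> w i = 0 \<Longrightarrow> j \<in> I \<Longrightarrow> w j \<noteq> 0
         \<Longrightarrow> qf b I w > 0"
    and c_pos: "i \<in> I \<Longrightarrow> c i > 0"
    and c_neg: "qf b I c < 0"
    and diag_pos: "i \<in> I \<Longrightarrow> b i i > 0"
begin

lemma finite_I [simp, intro]: "finite I" by simp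

text \<open>
  The form is concave along the line \<open>c + s * w\<close> as soon as it is not positive at \<open>w\<close>, and it is
  negative at \<open>s = 0\<close>.  Going in the direction in which it does not increase at first, it stays
  negative.  If \<open>w\<close> has a negative entry, the line leaves the cone through a proper face, and there
  the form is positive; otherwise \<open>w\<close> itself lies in a proper face.
\<close>

lemma mixed_sign_pos_aux:
  assumes "i \<in> I" "w i \<le> 0" "j \<in> I" "w j \<ge> 0" "k \<in> I" "w k \<noteq> 0"
    and dir: "(\<Sum>i\<in>I. w i * (\<Sum>j\<in>I. b i j * c j)) \<le> 0"
  shows "qf b I w > 0"
proof (cases "\<exists>l\<in>I. w l < 0")
  case False
  then have "w l \<ge> 0" if "l \<in> I" for l using that by force
  then show ?thesis using face_pos[of w i k] assms by force
next
  case True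
  \<comment> \<open>the parameter at which the line \<open>c + s * w\<close> reaches the boundary of the cone\<close>
  define s where "s = Min ((\<lambda>l. - c l / w l) ` {l\<in>I. w l < 0})"
  have fin: "finite ((\<lambda>l. - c l / w l) ` {l\<in>I. w l < 0})" "(\<lambda>l. - c l / w l) ` {l\<in>I. w l < 0} \<noteq> {}"
    using True by auto
  obtain l where l: "l \<in> I" "w l < 0" "s = - c l / w l"
    using Min_in[OF fin] unfolding s_def by auto
  have smin: "s \<le> - c m / w m" if "m \<in> I" "w m < 0" for m
    unfolding s_def using that by (intro Min_le) auto
  have s: "s > 0" using l c_pos[of l] by (simp add: divide_pos_neg)
  show ?thesis
  proof (rule ccontr)
    assume neg: "\<not> qf b I w > 0"
    have "2 * s * (\<Sum>i\<in>I. w i * (\<Sum>j\<in>I. b i j * c j)) \<le> 0"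
      using dir s by (simp add: mult_nonneg_nonpos)
    moreover have "s\<^sup>2 * qf b I w \<le> 0"
      using neg by (intro mult_nonneg_nonpos) auto
    ultimately have "qf b I (\<lambda>i. c i + s * w i) < 0"
      using qf_add[of b I c s w, OF sym] c_neg by linarith
    moreover have "qf b I (\<lambda>i. c i + s * w i) > 0"
    proof (rule face_pos[of _ l j])
      show "c m + s * w m \<ge> 0" if m: "m \<in> I" for m
      proof (cases "w m < 0")
        case True
        then show ?thesis using smin[OF m True] by (simp add: field_simps)
      next
        case False
        then show ?thesis using c_pos[OF m] s by (simp add: add_nonneg_nonneg order_less_imp_le)
      qed
      show "c l + s * w l = 0" using l by simp
      show "c j + s * w j \<noteq> 0" using c_pos[OF assms(3)] s assms(4)
        by (metis add_pos_nonneg less_imp_le mult_nonneg_nonneg less_irrefl)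
    qed (use l assms in auto)
    ultimately show False by simp
  qed
qed

text \<open>
  The only directions in which a critical form can fail to be positive are those with all entries of
  one strict sign.  This is what makes the form \<open>t \<mapsto> \<integral> qf b I (t u\<^sup>2)\<close> tractable: a vector \<open>t\<close> with
  entries of both signs gives such a vector \<open>t u(x)\<^sup>2\<close>, up to zeros, at each point \<open>x\<close>.
\<close>

lemma mixed_sign_pos:
  assumes "i \<in> I" "w i \<le> 0" "j \<in> I" "w j \<ge> 0" "k \<in> I" "w k \<noteq> 0"
  shows "qf b I w > 0"
proof (cases "(\<Sum>i\<in>I. w i * (\<Sum>j\<in>I. b i j * c j)) \<le> 0")
  case True
  show ?thesis by (rule mixed_sign_pos_aux[OF assms True])
next
  case False
  then have "(\<Sum>i\<in>I. - w i * (\<Sum>j\<in>I. b i j * c j)) \<le> 0" by (simp add: sum_negf)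
  from mixed_sign_pos_aux[where w="\<lambda>i. - w i", OF _ _ _ _ _ _ this] assms
  have "qf b I (\<lambda>i. - w i) > 0" by force
  then show ?thesis by (simp add: qf_uminus)
qed

end

text \<open>
  The least value of the form on the unit sphere is attained, hence positive.
\<close>

lemma posdef_coercive:
  fixes M :: "'n::finite \<Rightarrow> 'n \<Rightarrow> real"
  assumes "\<And>w. (\<exists>i\<in>I. w i \<noteq> 0) \<Longrightarrow> qf M I w > 0"
  obtains \<kappa> where "\<kappa> > 0" "\<And>w. \<kappa> * (\<Sum>i\<in>I. (w i)\<^sup>2) \<le> qf M I w"
proof (cases "I = {}")
  case True
  then show ?thesis using that[of 1] by (simp add: qf_def)
next
  case False
  define S where "S = {v::real^'n. (\<Sum>i\<in>I. (v $ i)\<^sup>2) = 1 \<and> (\<forall>i\<in>-I. v $ i = 0)}"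
  have "closed S" unfolding S_def Ball_def
    by (intro closed_Collect_conj closed_Collect_all closed_Collect_imp closed_Collect_eq
        continuous_intros) auto
  moreover have "S \<subseteq> cball 0 1"
  proof
    fix v assume v: "v \<in> S"
    have "(norm v)\<^sup>2 = (\<Sum>i\<in>UNIV. (v $ i)\<^sup>2)"
      by (simp add: norm_vec_def L2_set_def sum_nonneg)
    also have "\<dots> = (\<Sum>i\<in>I. (v $ i)\<^sup>2)"
      using v by (intro sum.mono_neutral_right) (auto simp: S_def)
    finally have "(norm v)\<^sup>2 = 1" using v by (simp add: S_def)
    then show "v \<in> cball 0 1" by (simp add: power2_eq_1_iff abs_square_le_1)
        (smt (verit) norm_ge_zero)
  qed
  ultimately have comp: "compact S"
    by (meson bounded_cball bounded_subset compact_eq_bounded_closed)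
  obtain i0 where "i0 \<in> I" using False by auto
  then have "axis i0 1 \<in> S" unfolding S_def axis_def
    by (auto simp: if_distrib[of "\<lambda>x. x\<^sup>2"] cong: if_cong)
  then have ne: "S \<noteq> {}" by auto
  have "continuous_on S (\<lambda>v. qf M I (\<lambda>i. v $ i))"
    unfolding qf_def by (intro continuous_intros)
  from continuous_attains_inf[OF comp ne this] obtain v0 where
    v0: "v0 \<in> S" "\<And>v. v \<in> S \<Longrightarrow> qf M I (\<lambda>i. v0 $ i) \<le> qf M I (\<lambda>i. v $ i)" by blast
  have "\<exists>i\<in>I. v0 $ i \<noteq> 0"
  proof (rule ccontr)
    assume "\<not> ?thesis"
    then have "(\<Sum>i\<in>I. (v0 $ i)\<^sup>2) = 0" by simp
    then show False using v0 by (simp add: S_def)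
  qed
  then have pos: "qf M I (\<lambda>i. v0 $ i) > 0" using assms by blast
  show ?thesis
  proof (rule that[OF pos])
    fix w :: "'n \<Rightarrow> real"
    define r where "r = sqrt (\<Sum>i\<in>I. (w i)\<^sup>2)"
    have r2: "r\<^sup>2 = (\<Sum>i\<in>I. (w i)\<^sup>2)" unfolding r_def by (simp add: sum_nonneg)
    show "qf M I (\<lambda>i. v0 $ i) * (\<Sum>i\<in>I. (w i)\<^sup>2) \<le> qf M I w"
    proof (cases "r = 0")
      case True
      then have "w i = 0" if "i \<in> I" for i
        using r2 that by (simp add: sum_nonneg_eq_0_iff)
      then show ?thesis using True r2 by (simp add: qf_eq_0 flip: r2)
    next
      case False
      define v where "v = (\<chi> i. if i \<in> I then w i / r else 0)"
      have "v \<in> S" unfolding S_def v_def using False r2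
        by (simp add: power_divide flip: sum_divide_distrib) (metis power_not_zero)
      then have "qf M I (\<lambda>i. v0 $ i) \<le> qf M I (\<lambda>i. v $ i)" using v0 by blast
      also have "\<dots> = qf M I (\<lambda>i. (1/r) * w i)" by (rule qf_cong) (simp add: v_def)
      also have "\<dots> = (1/r)\<^sup>2 * qf M I w" by (rule qf_scale)
      finally show ?thesis using False by (simp add: r2[symmetric] field_simps)
    qed
  qed
qed

section \<open>Dirichlet energy on dyadic grids\<close>

text \<open>
  The inner product \<open>\<integral>\<^sub>0\<^sup>1 u' v'\<close> of the interpolations of \<open>u\<close> and \<open>v\<close> that are linear between the
  points \<open>j / 2\<^sup>k\<close>.
\<close>

definition grid_form :: "nat \<Rightarrow> (real \<Rightarrow> real) \<Rightarrow> (real \<Rightarrow> real) \<Rightarrow> real" where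
  "grid_form k u v = 2^k * (\<Sum>j<2^k. (u ((real j + 1) / 2^k) - u (real j / 2^k))
                                   * (v ((real j + 1) / 2^k) - v (real j / 2^k)))"

text \<open>
  For continuous \<open>u\<close> this says that \<open>u\<close> has a square integrable weak derivative with
  \<open>\<integral>\<^sub>0\<^sup>1 u'\<^sup>2 \<le> K\<close>.  As a family of inequalities between finitely many values of \<open>u\<close>, the condition
  passes to pointwise limits, so that lower semicontinuity of the energy comes for free.
\<close>

definition energy_le :: "(real \<Rightarrow> real) \<Rightarrow> real \<Rightarrow> bool" where
  "energy_le u K \<longleftrightarrow> (\<forall>k. grid_form k u u \<le> K)"

lemma sum_pairs: "(\<Sum>j<2 * n. g j) = (\<Sum>j<n. g (2 * j) + g (2 * j + 1 :: nat) :: real)"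
  by (induction n) (auto simp: algebra_simps)

lemma grid_form_Suc:
  "grid_form (Suc k) u v = 2^k * (\<Sum>j<2^k. 2 *
     ((u ((2 * real j + 1) / 2^Suc k) - u (real j / 2^k)) * (v ((2 * real j + 1) / 2^Suc k) - v (real j / 2^k))
    + (u ((real j + 1) / 2^k) - u ((2 * real j + 1) / 2^Suc k))
      * (v ((real j + 1) / 2^k) - v ((2 * real j + 1) / 2^Suc k))))"
proof -
  have e: "real (2 * j) / (2 * 2^k) = real j / 2^k" "real (2 * j) + 1 = 2 * real j + 1"
    "real (2 * j + 1) = 2 * real j + 1" "(2 * real j + 1 + 1) / (2 * 2^k) = (real j + 1) / 2^k"
    for j :: nat
    by (simp_all add: field_simps)
  show ?thesis
    unfolding grid_form_def power_Suc sum_pairs e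
    by (simp only: mult.assoc sum_distrib_left[symmetric])
qed

text \<open>
  Linear interpolation minimises the energy, so inserting midpoints can only increase it.
\<close>

lemma grid_form_mono: "grid_form k u u \<le> grid_form (Suc k) u u"
  unfolding grid_form_Suc unfolding grid_form_def
proof (intro mult_left_mono sum_mono)
  fix j :: nat
  have *: "(z - x) * (z - x) \<le> 2 * ((y - x) * (y - x) + (z - y) * (z - y))" for x y z :: real
    using sum_squares_ge_zero[of "z + x - 2 * y" 0] by (simp add: algebra_simps)
  show "(u ((real j + 1) / 2 ^ k) - u (real j / 2 ^ k)) * (u ((real j + 1) / 2 ^ k) - u (real j / 2 ^ k))
    \<le> 2 * ((u ((2 * real j + 1) / 2 ^ Suc k) - u (real j / 2 ^ k)) *
            (u ((2 * real j + 1) / 2 ^ Suc k) - u (real j / 2 ^ k)) +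
            (u ((real j + 1) / 2 ^ k) - u ((2 * real j + 1) / 2 ^ Suc k)) *
            (u ((real j + 1) / 2 ^ k) - u ((2 * real j + 1) / 2 ^ Suc k)))"
    by (rule *)
qed simp

lemma grid_form_le: "k \<le> l \<Longrightarrow> grid_form k u u \<le> grid_form l u u"
  by (rule lift_Suc_mono_le[of "\<lambda>k. grid_form k u u"]) (rule grid_form_mono)

lemma energy_le_eventually:
  assumes "\<And>k. k \<ge> m \<Longrightarrow> grid_form k u u \<le> K"
  shows "energy_le u K"
  unfolding energy_le_def using assms grid_form_le by (meson order_trans nat_le_linear)

lemma grid_form_nonneg: "grid_form k u u \<ge> 0"
  unfolding grid_form_def by (simp add: sum_nonneg)

lemma energy_le_nonneg: "energy_le u K \<Longrightarrow> K \<ge> 0"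
  using grid_form_nonneg[of 0 u] by (force simp: energy_le_def intro: order_trans)

lemma energy_le_mono: "energy_le u K \<Longrightarrow> K \<le> K' \<Longrightarrow> energy_le u K'"
  by (meson energy_le_def order_trans)

lemma grid_form_add:
  "grid_form k (\<lambda>x. u x + e * v x) (\<lambda>x. u x + e * v x)
     = grid_form k u u + 2 * e * grid_form k u v + e\<^sup>2 * grid_form k v v"
  unfolding grid_form_def
  by (simp add: sum_distrib_left sum.distrib[symmetric] power2_eq_square algebra_simps)

lemma grid_form_scale: "grid_form k (\<lambda>x. s * u x) (\<lambda>x. s * u x) = s\<^sup>2 * grid_form k u u"
  unfolding grid_form_def
  by (simp add: sum_distrib_left power2_eq_square algebra_simps)

lemma energy_le_scale: "energy_le u K \<Longrightarrow> energy_le (\<lambda>x. s * u x) (s\<^sup>2 * K)"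
  unfolding energy_le_def grid_form_scale by (simp add: mult_left_mono)

lemma energy_le_abs: "energy_le u K \<Longrightarrow> energy_le (\<lambda>x. \<bar>u x\<bar>) K"
proof -
  have *: "(\<bar>x\<bar> - \<bar>y\<bar>) * (\<bar>x\<bar> - \<bar>y\<bar>) \<le> (x - y) * (x - y)" for x y :: real
    by (metis abs_le_square_iff abs_triangle_ineq3 power2_eq_square)
  have "grid_form k (\<lambda>x. \<bar>u x\<bar>) (\<lambda>x. \<bar>u x\<bar>) \<le> grid_form k u u" for k
    unfolding grid_form_def by (intro mult_left_mono sum_mono *) auto
  then show "energy_le u K \<Longrightarrow> energy_le (\<lambda>x. \<bar>u x\<bar>) K"
    unfolding energy_le_def by (meson order_trans)
qed

lemma energy_le_limit:
  assumes "\<And>x. (\<lambda>n. u n x) \<longlonglongrightarrow> v x" "a \<longlonglongrightarrow> A" "\<And>n. energy_le (u n) (a n)"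
  shows "energy_le v A"
  unfolding energy_le_def
proof
  fix k
  have "(\<lambda>n. grid_form k (u n) (u n)) \<longlonglongrightarrow> grid_form k v v"
    unfolding grid_form_def by (intro tendsto_intros assms)
  then show "grid_form k v v \<le> A"
    by (rule LIMSEQ_le[OF _ assms(2)]) (use assms(3) in \<open>auto simp: energy_le_def\<close>)
qed

lemma floor_grid_tendsto: "(\<lambda>k. of_int \<lfloor>2^k * x\<rfloor> / 2^k) \<longlonglongrightarrow> (x::real)"
proof (rule tendsto_sandwich)
  have le: "of_int \<lfloor>2^k * x\<rfloor> \<le> 2^k * x" "2^k * x - 1 \<le> of_int \<lfloor>2^k * x\<rfloor>" for k :: nat
    by linarith+
  show "\<forall>\<^sub>F k in sequentially. x - (1/2)^k \<le> of_int \<lfloor>2^k * x\<rfloor> / 2^k"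
  proof (intro always_eventually allI)
    fix k :: nat
    show "x - (1/2)^k \<le> of_int \<lfloor>2^k * x\<rfloor> / 2^k"
      using divide_right_mono[OF le(2)[of k], of "2^k"] by (simp add: diff_divide_distrib power_one_over)
  qed
  show "\<forall>\<^sub>F k in sequentially. of_int \<lfloor>2^k * x\<rfloor> / 2^k \<le> x"
    using le(1) by (intro always_eventually allI) (simp add: divide_le_eq mult.commute)
  show "(\<lambda>k. x - (1/2)^k) \<longlonglongrightarrow> x"
    using tendsto_diff[OF tendsto_const LIMSEQ_power_zero[of "1/2::real"], of x] by simp
qed simp

lemma floor_grid_tendsto_nat: "(\<lambda>k. real (nat \<lfloor>2^k * x\<rfloor>) / 2^k) \<longlonglongrightarrow> x" if "x \<ge> 0"
  using floor_grid_tendsto[of x] that by simp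

text \<open>
  The embedding of \<open>H\<^sup>1\<close> into the Hoelder functions of exponent \<open>1/2\<close>: write the increment as
  a telescoping sum and apply the Cauchy-Schwarz inequality.
\<close>

lemma energy_holder_grid:
  assumes "energy_le u K" "i \<le> j" "j \<le> 2^k"
  shows "(u (real j / 2^k) - u (real i / 2^k))\<^sup>2 \<le> K * (real j / 2^k - real i / 2^k)"
proof -
  define d where "d l = u (real (Suc l) / 2^k) - u (real l / 2^k)" for l :: nat
  have "u (real j / 2^k) - u (real i / 2^k) = (\<Sum>l=i..<j. d l)"
    unfolding d_def using sum_Suc_diff'[OF assms(2), of "\<lambda>l. u (real l / 2^k)"] by simp
  then have cs: "(u (real j / 2^k) - u (real i / 2^k))\<^sup>2 \<le> (\<Sum>l=i..<j. (d l)\<^sup>2) * (real j - real i)"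
    using Cauchy_Schwarz_ineq_sum[of d "\<lambda>_. 1" "{i..<j}"] assms(2) by (simp add: of_nat_diff)
  have "(\<Sum>l=i..<j. (d l)\<^sup>2) \<le> (\<Sum>l<2^k. (d l)\<^sup>2)"
    using assms by (intro sum_mono2) auto
  also have "(\<Sum>l<2^k. (d l)\<^sup>2) = grid_form k u u / 2^k"
    unfolding grid_form_def d_def by (simp add: power2_eq_square algebra_simps)
  also have "\<dots> \<le> K / 2^k"
    using assms(1) by (simp add: energy_le_def divide_right_mono)
  finally have "(\<Sum>l=i..<j. (d l)\<^sup>2) * (real j - real i) \<le> K / 2^k * (real j - real i)"
    using assms(2) by (intro mult_right_mono) auto
  also have "\<dots> = K * (real j / 2^k - real i / 2^k)" by (simp add: field_simps)
  finally show ?thesis using cs by simp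
qed

lemma energy_holder_aux:
  assumes "energy_le u K" "continuous_on UNIV u" "0 \<le> x" "x \<le> y" "y \<le> 1"
  shows "(u y - u x)\<^sup>2 \<le> K * (y - x)"
proof -
  have u: "isCont u z" for z using assms(2) by (simp add: continuous_on_eq_continuous_at)
  have l: "(\<lambda>k. u (real (nat \<lfloor>2^k * z\<rfloor>) / 2^k)) \<longlonglongrightarrow> u z" if "z \<ge> 0" for z
    by (rule isCont_tendsto_compose[OF u floor_grid_tendsto_nat[OF that]])
  have "y \<ge> 0" using assms by simp
  show ?thesis
  proof (rule LIMSEQ_le)
    show "(\<lambda>k. (u (real (nat \<lfloor>2^k * y\<rfloor>) / 2^k) - u (real (nat \<lfloor>2^k * x\<rfloor>) / 2^k))\<^sup>2) \<longlonglongrightarrow> (u y - u x)\<^sup>2"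
      by (intro tendsto_intros l assms \<open>y \<ge> 0\<close>)
    show "(\<lambda>k. K * (real (nat \<lfloor>2^k * y\<rfloor>) / 2^k - real (nat \<lfloor>2^k * x\<rfloor>) / 2^k)) \<longlonglongrightarrow> K * (y - x)"
      by (intro tendsto_intros floor_grid_tendsto_nat assms \<open>y \<ge> 0\<close>)
    have "nat \<lfloor>2^k * y\<rfloor> \<le> 2^k" for k :: nat
    proof -
      have "\<lfloor>2^k * y\<rfloor> \<le> \<lfloor>2^k :: real\<rfloor>" using assms by (intro floor_mono) simp
      also have "\<lfloor>2^k :: real\<rfloor> = int (2^k)" by (metis floor_of_nat of_nat_numeral of_nat_power)
      finally show ?thesis by linarith
    qed
    moreover have "nat \<lfloor>2^k * x\<rfloor> \<le> nat \<lfloor>2^k * y\<rfloor>" for k :: nat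
      using assms(4) by (intro nat_mono floor_mono mult_left_mono) auto
    ultimately show "\<exists>N. \<forall>k\<ge>N. (u (real (nat \<lfloor>2^k * y\<rfloor>) / 2^k) - u (real (nat \<lfloor>2^k * x\<rfloor>) / 2^k))\<^sup>2
        \<le> K * (real (nat \<lfloor>2^k * y\<rfloor>) / 2^k - real (nat \<lfloor>2^k * x\<rfloor>) / 2^k)"
      using energy_holder_grid[OF assms(1)] by blast
  qed
qed

lemma energy_holder:
  assumes "energy_le u K" "continuous_on UNIV u" "x \<in> {0..1}" "y \<in> {0..1}"
  shows "(u y - u x)\<^sup>2 \<le> K * \<bar>y - x\<bar>"
proof (cases "x \<le> y")
  case True
  then show ?thesis using energy_holder_aux[of u K x y] assms by auto
next
  case False
  then show ?thesis using energy_holder_aux[of u K y x] assms by (auto simp: power2_commute)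
qed

section \<open>Dyadic hat functions\<close>

lemma infdist_Ints: "infdist x \<int> = min (frac x) (1 - frac x)" for x :: real
proof (rule antisym)
  have "infdist x \<int> \<le> dist x (of_int \<lfloor>x\<rfloor>)" "infdist x \<int> \<le> dist x (of_int (\<lfloor>x\<rfloor> + 1))"
    by (rule infdist_le, simp)+
  moreover have "dist x (of_int \<lfloor>x\<rfloor>) = frac x" "dist x (of_int (\<lfloor>x\<rfloor> + 1)) = 1 - frac x"
    unfolding dist_real_def frac_def by linarith+
  ultimately show "infdist x \<int> \<le> min (frac x) (1 - frac x)" by simp
  have "min (frac x) (1 - frac x) \<le> dist x a" if "a \<in> \<int>" for a
  proof -
    obtain n where n: "a = of_int n" using \<open>a \<in> \<int>\<close> by (auto elim: Ints_cases)
    show ?thesis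
    proof (cases "n \<le> \<lfloor>x\<rfloor>")
      case True
      then have "a \<le> of_int \<lfloor>x\<rfloor>" by (simp add: n)
      then show ?thesis unfolding dist_real_def frac_def by linarith
    next
      case False
      then have "a \<ge> of_int \<lfloor>x\<rfloor> + 1" by (simp add: n)
      then show ?thesis unfolding dist_real_def frac_def by linarith
    qed
  qed
  then show "min (frac x) (1 - frac x) \<le> infdist x \<int>"
    unfolding infdist_def using Ints_0 by (auto intro!: cINF_greatest)
qed

text \<open>
  The periodic tent with peaks of height 1 at the integers and supports of half-width \<open>1 / 2\<^sup>m\<close>.
\<close>

definition hat :: "nat \<Rightarrow> real \<Rightarrow> real" where
  "hat m x = max 0 (1 - 2^m * infdist x \<int>)"

lemma hat_add_int: "hat m (x + of_int k) = hat m x"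
  unfolding hat_def infdist_Ints by (simp add: frac_def)

lemma hat_01: "0 \<le> y \<Longrightarrow> y \<le> 1 \<Longrightarrow> hat m y = max 0 (1 - 2^m * min y (1 - y))"
  by (cases "y = 1") (auto simp: hat_def infdist_Ints frac_eq[THEN iffD2])

lemma continuous_hat [continuous_intros]: "continuous_on S f \<Longrightarrow> continuous_on S (\<lambda>x. hat m (f x))"
  unfolding hat_def by (intro continuous_intros)

text \<open>
  All kinks of the tent lie on the grid of width \<open>1 / 2\<^sup>m\<close>, as \<open>m \<ge> 1\<close> keeps neighbouring tents
  apart; on the cells of a finer grid the tent is affine.
\<close>

lemma hat_cell_affine:
  fixes z :: int
  assumes "1 \<le> m" "m \<le> k"
  shows "hat m ((2 * of_int z + 1) / 2^Suc k)
    = (hat m (of_int z / 2^k) + hat m ((of_int z + 1) / 2^k)) / 2"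
proof -
  define e where "e = z div 2^k"
  define z0 where "z0 = z mod 2^k"
  have z: "z = e * 2^k + z0" by (simp only: e_def z0_def div_mult_mod_eq)
  have z0: "0 \<le> z0" "z0 < 2^k" unfolding z0_def by simp_all
  define y where "y = real_of_int z0 / 2^k"
  define h where "h = (1::real) / 2^k"
  have shift: "hat m (of_int z / 2^k) = hat m y"
    "hat m ((of_int z + 1) / 2^k) = hat m (y + h)"
    "hat m ((2 * of_int z + 1) / 2^Suc k) = hat m (y + h/2)"
  proof -
    have "of_int z / 2^k = y + of_int e" "(of_int z + 1) / 2^k = y + h + of_int e"
      "(2 * of_int z + 1) / 2^Suc k = y + h/2 + of_int e"
      unfolding z y_def h_def by (simp_all add: field_simps)
    then show "hat m (of_int z / 2^k) = hat m y" "hat m ((of_int z + 1) / 2^k) = hat m (y + h)"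
      "hat m ((2 * of_int z + 1) / 2^Suc k) = hat m (y + h/2)"
      by (simp_all only: hat_add_int)
  qed
  have K: "(2::real)^k = 2^m * 2^(k-m)" using assms by (simp flip: power_add)
  have h: "h > 0" by (simp add: h_def)
  have y: "0 \<le> y" "y + h \<le> 1"
  proof -
    have "real_of_int (z0 + 1) \<le> real_of_int (2^k)"
      using z0(2) by (simp only: of_int_le_iff)
    then have "real_of_int z0 + 1 \<le> 2^k" by simp
    then show "y + h \<le> 1" by (simp add: y_def h_def field_simps)
  qed (use z0 in \<open>simp add: y_def\<close>)
  define H where "H = (1::real) / 2^m"
  have H: "0 < H" "H \<le> 1/2" using assms power_increasing[of 1 m "2::real"]
    by (simp_all add: H_def field_simps)
  have m: "2^m = 1 / H" by (simp add: H_def)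
  have hh: "0 \<le> y" "y \<le> 1" "0 \<le> y + h" "y + h \<le> 1" "0 \<le> y + h/2" "y + h/2 \<le> 1"
    using y h by simp_all
  have HK: "H = 2^(k-m) / 2^k" by (simp add: H_def K)
  have yh: "y + h = (real_of_int z0 + 1) / 2^k" by (simp add: y_def h_def add_divide_distrib)
  have HK1: "1 - H = (2^k - 2^(k-m)) / 2^k" by (simp add: HK diff_divide_distrib)
  consider "y + h \<le> H" | "H \<le> y" "y + h \<le> 1 - H" | "1 - H \<le> y"
  proof -
    have a: "y + h \<le> H" if "z0 < 2^(k-m)"
    proof -
      have "real_of_int (z0 + 1) \<le> real_of_int (2^(k-m))" using that by (simp only: of_int_le_iff)
      then show ?thesis unfolding yh HK by (intro divide_right_mono) auto
    qed
    have b: "H \<le> y" if "\<not> z0 < 2^(k-m)"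
    proof -
      have "real_of_int z0 \<ge> real_of_int (2^(k-m))" using that by (simp only: of_int_le_iff)
      then show ?thesis unfolding y_def HK by (intro divide_right_mono) auto
    qed
    have c: "y + h \<le> 1 - H" if "z0 < 2^k - 2^(k-m)"
    proof -
      have "real_of_int (z0 + 1) \<le> real_of_int (2^k - 2^(k-m))" using that by (simp only: of_int_le_iff)
      then show ?thesis unfolding yh HK1 by (intro divide_right_mono) auto
    qed
    have d: "1 - H \<le> y" if "\<not> z0 < 2^k - 2^(k-m)"
    proof -
      have "real_of_int z0 \<ge> real_of_int (2^k - 2^(k-m))" using that by (simp only: of_int_le_iff)
      then show ?thesis unfolding y_def HK1 by (intro divide_right_mono) auto
    qed
    show thesis using a b c d that by blast
  qed
  then show ?thesis
  proof cases
    case 1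
    have "hat m t = 1 - t / H" if "0 \<le> t" "t \<le> H" for t
      using that H by (auto simp: hat_01 m min_def field_simps)
    from this[of y] this[of "y + h"] this[of "y + h/2"] 1 hh h show ?thesis
      unfolding shift by (simp add: add_divide_distrib diff_divide_distrib)
  next
    case 2
    have "hat m t = 0" if "H \<le> t" "t \<le> 1 - H" for t
      using that H by (auto simp: hat_01 m min_def field_simps)
    from this[of y] this[of "y + h"] this[of "y + h/2"] 2 hh h show ?thesis
      unfolding shift by simp
  next
    case 3
    have "hat m t = 1 - (1 - t) / H" if "1 - H \<le> t" "t \<le> 1" for t
      using that H by (auto simp: hat_01 m min_def field_simps)
    from this[of y] this[of "y + h"] this[of "y + h/2"] 3 hh h show ?thesis
      unfolding shift by (simp add: add_divide_distrib diff_divide_distrib)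
  qed
qed

lemma hat_grid:
  fixes z :: int
  assumes "1 \<le> m"
  shows "hat m (of_int z / 2^m) = (if 2^m dvd z then 1 else 0)"
proof -
  define e where "e = z div 2^m"
  define z0 where "z0 = z mod 2^m"
  have z: "z = e * 2^m + z0" by (simp only: e_def z0_def div_mult_mod_eq)
  have z0: "0 \<le> z0" "z0 < 2^m" unfolding z0_def by simp_all
  have shift: "hat m (of_int z / 2^m) = hat m (of_int z0 / 2^m)"
    using hat_add_int[of m "of_int z0 / 2^m" e] by (simp add: z field_simps)
  show ?thesis
  proof (cases "z0 = 0")
    case True
    then show ?thesis using shift by (simp add: hat_01 z0_def dvd_eq_mod_eq_0)
  next
    case False
    then have "1 \<le> z0" "z0 + 1 \<le> 2^m" using z0 by auto
    then have "real_of_int 1 \<le> real_of_int z0" "real_of_int (z0 + 1) \<le> real_of_int (2^m)"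
      by (simp_all del: of_int_add of_int_power)
    then have "1 / 2^m \<le> of_int z0 / (2^m :: real)" "(of_int z0 + 1) / (2^m :: real) \<le> 1"
      by (simp_all add: divide_right_mono)
    then have y: "1 / 2^m \<le> min (of_int z0 / 2^m) (1 - of_int z0 / (2^m :: real))"
      by (simp add: add_divide_distrib)
    then have "1 \<le> 2^m * min (of_int z0 / 2^m) (1 - of_int z0 / (2^m :: real))"
      by (simp only: divide_le_eq) (simp add: mult.commute)
    moreover have "0 \<le> 1 / (2^m :: real)" by simp
    ultimately have "hat m (of_int z0 / 2^m) = 0" using y by (subst hat_01) linarith+
    then show ?thesis using False shift by (simp add: z0_def dvd_eq_mod_eq_0)
  qed
qed

text \<open>
  Against a function that is affine on each cell, refining the grid only splits each
  increment of \<open>u\<close> into two that are multiplied by the same slope.  This is why hats are the test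
  functions: their inner product with \<open>u\<close> needs no limit.
\<close>

lemma grid_form_hat_stable:
  fixes q :: int
  assumes "1 \<le> m" "m \<le> k"
  shows "grid_form k u (\<lambda>x. hat m (x - of_int q / 2^m)) = grid_form m u (\<lambda>x. hat m (x - of_int q / 2^m))"
  using assms(2)
proof (induction k rule: dec_induct)
  case base
  then show ?case by simp
next
  case (step k)
  let ?v = "\<lambda>x. hat m (x - of_int q / 2^m)"
  have mid: "?v ((2 * real j + 1) / 2^Suc k) = (?v (real j / 2^k) + ?v ((real j + 1) / 2^k)) / 2" for j :: nat
  proof -
    define z :: int where "z = int j - q * 2^(k-m)"
    have K: "(2::real)^k = 2^m * 2^(k-m)" using step by (simp flip: power_add)
    have "(2 * real j + 1) / 2^Suc k - of_int q / 2^m = (2 * of_int z + 1) / 2^Suc k"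
      "real j / 2^k - of_int q / 2^m = of_int z / 2^k"
      "(real j + 1) / 2^k - of_int q / 2^m = (of_int z + 1) / 2^k"
      by (simp_all add: z_def K field_simps)
    then show ?thesis using hat_cell_affine[OF assms(1), of k z] step by metis
  qed
  have "grid_form (Suc k) u ?v = grid_form k u ?v"
    unfolding grid_form_Suc mid unfolding grid_form_def
    by (rule arg_cong[where f="\<lambda>s. 2^k * s"], rule sum.cong[OF refl]) (simp add: field_simps)
  then show ?case using step by simp
qed

text \<open>
  Only the two cells next to \<open>q / 2\<^sup>m\<close> contribute, which leaves a second difference of \<open>u\<close>.  For
  \<open>q = 0\<close> the left one of them is the last cell of the period.
\<close>

lemma grid_form_hat:
  fixes q :: nat
  assumes "1 \<le> m" "q < 2^m" and per: "\<And>x. u (x + 1) = u x"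
  shows "grid_form m u (\<lambda>x. hat m (x - real q / 2^m))
    = 2^m * (2 * u (real q / 2^m) - u ((real q + 1) / 2^m) - u ((real q - 1) / 2^m))"
proof -
  let ?v = "\<lambda>x. hat m (x - real q / 2^m)"
  let ?N = "2^m :: nat"
  have val: "?v (real j / 2^m) = (if 2^m dvd int j - int q then 1 else 0)" for j
    using hat_grid[OF assms(1), of "int j - int q"] by (simp add: diff_divide_distrib)
  have v0: "?v (real j / 2^m) = (if j = q then 1 else 0)" if "j < ?N" for j
  proof -
    have "2^m dvd int j - int q \<longleftrightarrow> j = q"
    proof
      assume "2^m dvd int j - int q"
      then have "int j mod 2^m = int q mod 2^m" by (simp add: mod_eq_dvd_iff)
      moreover have "int j < int ?N" "int q < int ?N"
        using that assms(2) by (simp_all only: of_nat_less_iff)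
      ultimately show "j = q" by simp
    qed auto
    then show ?thesis unfolding val by simp
  qed
  \<comment> \<open>the cell whose right end point is the peak\<close>
  define q' where "q' = (if q = 0 then ?N - 1 else q - 1)"
  have q': "q' < ?N" using assms unfolding q'_def by (simp add: less_imp_diff_less)
  have v1: "?v ((real j + 1) / 2^m) = (if j = q' then 1 else 0)" if "j < ?N" for j
  proof (cases "Suc j = ?N")
    case True
    then have "?v (real (Suc j) / 2^m) = ?v 0"
      using hat_add_int[of m "0 - real q / 2^m" 1] by (simp add: True)
    also have "\<dots> = (if 0 = q then 1 else 0)" using v0[of 0] by simp
    also have "\<dots> = (if j = q' then 1 else 0)"
      using True assms unfolding q'_def by auto
    finally show ?thesis by (simp add: add.commute)
  next
    case False
    then have "Suc j < ?N" using that by simp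
    from v0[OF this] show ?thesis using False unfolding q'_def by (auto simp: add.commute)
  qed
  let ?d = "\<lambda>j. u ((real j + 1) / 2^m) - u (real j / 2^m)"
  have "(\<Sum>j<?N. ?d j * (?v ((real j + 1) / 2^m) - ?v (real j / 2^m)))
      = (\<Sum>j<?N. (if j = q' then ?d j else 0)) - (\<Sum>j<?N. (if j = q then ?d j else 0))"
    unfolding sum_subtractf[symmetric]
  proof (rule sum.cong[OF refl])
    fix j assume "j \<in> {..<?N}"
    then have j: "j < ?N" by simp
    show "?d j * (?v ((real j + 1) / 2^m) - ?v (real j / 2^m))
      = (if j = q' then ?d j else 0) - (if j = q then ?d j else 0)"
      unfolding v0[OF j] v1[OF j] by simp
  qed
  also have "\<dots> = ?d q' - ?d q" using q' assms by (simp add: sum.delta)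
  also have "?d q' = u (real q / 2^m) - u ((real q - 1) / 2^m)"
  proof (cases "q = 0")
    case True
    have "(real ?N - 1) / 2^m = (0 - 1) / 2^m + 1" by (simp add: field_simps)
    have "u ((real ?N - 1) / 2^m) = u (- 1 / 2^m)" using per[of "- 1 / 2^m"] by (simp add: diff_divide_distrib)
    moreover have "u (real ?N / 2^m) = u 0" using per[of 0] by simp
    ultimately show ?thesis using True unfolding q'_def by (simp add: of_nat_diff)
  next
    case False
    then show ?thesis unfolding q'_def by (simp add: of_nat_diff)
  qed
  finally show ?thesis unfolding grid_form_def by simp
qed

lemma energy_le_add_hat:
  fixes q :: int
  assumes "energy_le u K" "1 \<le> m"
  defines "v \<equiv> (\<lambda>x. hat m (x - of_int q / 2^m))"
  shows "energy_le (\<lambda>x. u x + e * v x) (K + e * (2 * grid_form m u v) + e\<^sup>2 * grid_form m v v)"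
proof (rule energy_le_eventually)
  fix k assume "m \<le> k"
  then have "grid_form k u v = grid_form m u v" "grid_form k v v = grid_form m v v"
    unfolding v_def by (rule grid_form_hat_stable[OF assms(2)])+
  then show "grid_form k (\<lambda>x. u x + e * v x) (\<lambda>x. u x + e * v x)
    \<le> K + e * (2 * grid_form m u v) + e\<^sup>2 * grid_form m v v"
    using assms(1) unfolding grid_form_add by (simp add: energy_le_def mult_ac)
qed

lemma energy_le_hat:
  fixes q :: int
  assumes "1 \<le> m"
  shows "\<exists>K. energy_le (\<lambda>x. hat m (x - of_int q / 2^m)) K"
proof -
  have "energy_le (\<lambda>x. 0) 0" by (simp add: energy_le_def grid_form_def)
  from energy_le_add_hat[OF this assms, of 1 q] show ?thesis by (auto intro: exI)
qed

section \<open>From the weak equation to a classical solution\<close>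

text \<open>
  The difference of two integrals takes care of both signs of \<open>x\<close>: one of them is always over a
  set with at most one point.
\<close>

lemma antiderivative_real:
  fixes g :: "real \<Rightarrow> real"
  assumes "continuous_on UNIV g"
  obtains G where "\<And>x. (G has_real_derivative g x) (at x)"
proof -
  define G where "G x = integral {0..x} g - integral {x..0} g" for x
  have int: "g integrable_on {a..b}" for a b
    using assms continuous_on_subset by (blast intro: integrable_continuous_real)
  have "(G has_real_derivative g x) (at x)" for x
  proof -
    define R where "R = \<bar>x\<bar> + 1"
    have eq: "G y = integral {-R..y} g - integral {-R..0} g" if "y \<in> {-R..R}" for y
    proof (cases "y \<ge> 0")
      case True
      have "integral {-R..0} g + integral {0..y} g = integral {-R..y} g"
        using True that int by (intro Henstock_Kurzweil_Integration.integral_combine) auto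
      moreover have "integral {y..0} g = 0" using True by (cases "y = 0") auto
      ultimately show ?thesis unfolding G_def by simp
    next
      case False
      have "integral {-R..y} g + integral {y..0} g = integral {-R..0} g"
        using False that int by (intro Henstock_Kurzweil_Integration.integral_combine) auto
      then show ?thesis using False unfolding G_def by simp
    qed
    have x: "x \<in> {-R<..<R}" unfolding R_def by auto
    have "((\<lambda>y. integral {-R..y} g) has_real_derivative g x) (at x within {-R..R})"
      using x by (intro integral_has_real_derivative continuous_on_subset[OF assms]) auto
    then have "((\<lambda>y. integral {-R..y} g - integral {-R..0} g) has_real_derivative g x) (at x)"
      using x at_within_interior[of x "{-R..R}"] by (auto intro!: derivative_eq_intros)
    then show ?thesis
      by (rule has_field_derivative_transform_within_open[of _ _ _ "{-R<..<R}"]) (use x eq in auto)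
  qed
  then show ?thesis using that by blast
qed

lemma has_integral_antiderivative:
  assumes "\<And>x. (G has_real_derivative g x) (at x)" "a \<le> b"
  shows "(g has_integral G b - G a) {a..b}"
  using assms by (intro fundamental_theorem_of_calculus)
    (auto simp flip: has_real_derivative_iff_has_vector_derivative intro: has_field_derivative_at_within)

lemma periodic_integral_shift:
  fixes g :: "real \<Rightarrow> real"
  assumes "continuous_on UNIV g" "\<And>x. g (x + 1) = g x"
  shows "integral {a..a + 1} g = integral {0..1} g"
proof -
  obtain G where G: "\<And>x. (G has_real_derivative g x) (at x)" using antiderivative_real assms by blast
  have "((\<lambda>x. G (x + 1) - G x) has_real_derivative 0) (at x)" for x
  proof -
    have "((\<lambda>x. G (x + 1)) has_real_derivative g (x + 1)) (at x)"
      using DERIV_shift[of G "g (x + 1)" x 1] G by simp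
    from DERIV_diff[OF this G] show ?thesis by (simp add: assms)
  qed
  then have "G (a + 1) - G a = G (0 + 1) - G 0"
    using DERIV_isconst_all[of "\<lambda>x. G (x + 1) - G x" a 0] by blast
  then show ?thesis
    using has_integral_antiderivative[OF G, of a "a+1"] has_integral_antiderivative[OF G, of 0 1]
    by (simp add: integral_unique)
qed

lemma periodic_int:
  assumes "\<And>x. g (x + 1) = g (x::real)"
  shows "g (x + of_int k) = g x"
proof (induction k rule: int_induct[where k=0])
  case (step1 i)
  then show ?case using assms[of "x + of_int i"] by (simp add: add.assoc)
next
  case (step2 i)
  then show ?case using assms[of "x + of_int (i - 1)"] by (simp add: add.assoc)
qed simp

lemma hat_near_0: "\<bar>y\<bar> \<le> 1/2 \<Longrightarrow> hat m y = max 0 (1 - 2^m * \<bar>y\<bar>)"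
proof (cases "y \<ge> 0")
  case True
  assume "\<bar>y\<bar> \<le> 1/2"
  then have "min y (1 - y) = y" using True by simp
  with \<open>\<bar>y\<bar> \<le> 1/2\<close> True show ?thesis using hat_01[of y m] by simp
next
  case False
  assume "\<bar>y\<bar> \<le> 1/2"
  then have "min (y + 1) (1 - (y + 1)) = - y" using False by simp
  with \<open>\<bar>y\<bar> \<le> 1/2\<close> False show ?thesis using hat_01[of "y + 1" m] hat_add_int[of m y 1] by simp
qed

text \<open>
  Integration by parts on the two halves of the support.  Together with \<open>grid_form_hat\<close> it shows that
  a classical solution of \<open>W'' = - F\<close> satisfies exactly the same second difference equations as
  a weak one.
\<close>

lemma integral_hat:
  assumes F: "continuous_on UNIV F" "\<And>x. F (x + 1) = F x" and m: "1 \<le> m"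
    and W: "\<And>x. (W has_real_derivative W1 x) (at x)" "\<And>x. (W1 has_real_derivative - F x) (at x)"
  shows "integral {0..1} (\<lambda>x. F x * hat m (x - p))
    = 2^m * (2 * W p - W (p + 1/2^m) - W (p - 1/2^m))"
proof -
  define h where "h = (1::real) / 2^m"
  have h: "0 < h" "h \<le> 1/2" using m power_increasing[of 1 m "2::real"] by (simp_all add: h_def field_simps)
  have m': "2^m = 1 / h" by (simp add: h_def)
  let ?f = "\<lambda>x. F x * hat m (x - p)"
  have "hat m (x + 1 - p) = hat m (x - p)" for x
    using hat_add_int[of m "x - p" 1] by (simp add: algebra_simps)
  then have "integral {p - 1/2..p - 1/2 + 1} ?f = integral {0..1} ?f"
    by (intro periodic_integral_shift continuous_intros F continuous_on_subset[OF F(1)]) (auto simp: F)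
  moreover have "(?f has_integral 0) {p - 1/2..p - h}"
    by (rule has_integral_is_0) (use h in \<open>auto simp: hat_near_0 m' field_simps\<close>)
  moreover have "(?f has_integral (- W1 p + W p / h - W (p - h) / h)) {p - h..p}"
  proof -
    have "((\<lambda>x. - W1 x * (1 + (x - p) / h) + W x / h) has_real_derivative F x * (1 + (x - p) / h)) (at x)" for x
      using h by (auto intro!: derivative_eq_intros W simp: field_simps)
    from has_integral_antiderivative[OF this, of "p - h" p]
    have "((\<lambda>x. F x * (1 + (x - p) / h)) has_integral (- W1 p + W p / h - W (p - h) / h)) {p - h..p}"
      using h by (simp add: algebra_simps)
    then show ?thesis
      by (rule has_integral_eq[rotated]) (use h in \<open>auto simp: hat_near_0 m' field_simps\<close>)
  qed
  moreover have "(?f has_integral (W1 p + W p / h - W (p + h) / h)) {p..p + h}"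
  proof -
    have "((\<lambda>x. - W1 x * (1 - (x - p) / h) - W x / h) has_real_derivative F x * (1 - (x - p) / h)) (at x)" for x
      using h by (auto intro!: derivative_eq_intros W simp: field_simps)
    from has_integral_antiderivative[OF this, of p "p + h"]
    have "((\<lambda>x. F x * (1 - (x - p) / h)) has_integral (W1 p + W p / h - W (p + h) / h)) {p..p + h}"
      using h by (simp add: algebra_simps)
    then show ?thesis
      by (rule has_integral_eq[rotated]) (use h in \<open>auto simp: hat_near_0 m' field_simps\<close>)
  qed
  moreover have "(?f has_integral 0) {p + h..p + 1/2}"
    by (rule has_integral_is_0) (use h in \<open>auto simp: hat_near_0 m' field_simps\<close>)
  ultimately have "(?f has_integral (((0 + (- W1 p + W p / h - W (p - h) / h))
      + (W1 p + W p / h - W (p + h) / h)) + 0)) {p - 1/2..p + 1/2}"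
    using h by (intro has_integral_combine[of "p - 1/2" "p + h" "p + 1/2"]
       has_integral_combine[of "p - 1/2" p "p + h"] has_integral_combine[of "p - 1/2" "p - h" p]) auto
  then have "integral {p - 1/2..p - 1/2 + 1} ?f = (2 * W p - W (p + h) - W (p - h)) / h"
    by (simp add: integral_unique add_divide_distrib diff_divide_distrib algebra_simps)
  with \<open>integral {p - 1/2..p - 1/2 + 1} ?f = integral {0..1} ?f\<close> show ?thesis
    by (simp add: h_def mult.commute)
qed

text \<open>
  On each grid the increments of \<open>D\<close> are constant, so \<open>D\<close> is affine there with the slope
  fixed by its values at 0 and 1; continuity does the rest.
\<close>

lemma dyadic_affine:
  fixes D :: "real \<Rightarrow> real"
  assumes cont: "continuous_on UNIV D"
    and second_diff: "\<And>m q. 1 \<le> m \<Longrightarrow>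
      2 * D (of_int q / 2^m) = D ((of_int q + 1) / 2^m) + D ((of_int q - 1) / 2^m)"
  shows "D x = D 0 + x * (D 1 - D 0)"
proof -
  have dyadic: "D (of_int q / 2^m) = D 0 + of_int q / 2^m * (D 1 - D 0)" if m: "1 \<le> m" for q m
  proof -
    define c where "c = D (1 / 2^m) - D 0"
    have inc: "D ((of_int q + 1) / 2^m) - D (of_int q / 2^m) = c" for q
    proof (induction q rule: int_induct[where k=0])
      case (step1 i)
      then show ?case using second_diff[OF m, of "i + 1"] by simp
    next
      case (step2 i)
      then show ?case using second_diff[OF m, of i] by simp
    qed (simp add: c_def)
    have lin: "D (of_int q / 2^m) = D 0 + of_int q * c" for q
    proof (induction q rule: int_induct[where k=0])
      case (step1 i)
      then show ?case using inc[of i] by (simp add: algebra_simps)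
    next
      case (step2 i)
      then show ?case using inc[of "i - 1"] by (simp add: algebra_simps)
    qed simp
    from lin[of "2^m"] have "D 1 = D 0 + 2^m * c" by simp
    then show ?thesis using lin[of q] by (simp add: field_simps)
  qed
  have D: "isCont D z" for z using cont by (simp add: continuous_on_eq_continuous_at)
  have "(\<lambda>k. D (of_int \<lfloor>2^(Suc k) * x\<rfloor> / 2^(Suc k))) \<longlonglongrightarrow> D x"
    by (rule isCont_tendsto_compose[OF D LIMSEQ_Suc[OF floor_grid_tendsto]])
  moreover have "(\<lambda>k. D (of_int \<lfloor>2^(Suc k) * x\<rfloor> / 2^(Suc k))) \<longlonglongrightarrow> D 0 + x * (D 1 - D 0)"
    unfolding dyadic[OF le_add1[of 1, simplified plus_1_eq_Suc]]
    by (intro tendsto_intros LIMSEQ_Suc[OF floor_grid_tendsto])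
  ultimately show ?thesis by (rule LIMSEQ_unique)
qed

text \<open>
  Let \<open>W\<close> be a second antiderivative of \<open>- F\<close>.  All dyadic second differences of \<open>u - W\<close> vanish, so
  \<open>u - W\<close> is affine and \<open>u\<close> inherits the smoothness of \<open>W\<close>.
\<close>

lemma weak_solution_classical:
  assumes u: "continuous_on UNIV u" "\<And>x. u (x + 1) = u x"
    and F: "continuous_on UNIV F" "\<And>x. F (x + 1) = F x"
    and weak: "\<And>m q. 1 \<le> m \<Longrightarrow> q < 2^m \<Longrightarrow>
      grid_form m u (\<lambda>x. hat m (x - real q / 2^m)) = integral {0..1} (\<lambda>x. F x * hat m (x - real q / 2^m))"
  obtains u1 where "\<And>x. (u has_real_derivative u1 x) (at x)" "\<And>x. (u1 has_real_derivative - F x) (at x)"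
proof -
  obtain W1 where W1: "\<And>x. (W1 has_real_derivative - F x) (at x)"
    using antiderivative_real[of "\<lambda>x. - F x"] F by (auto intro: continuous_intros)
  have "continuous_on UNIV W1"
    using W1 DERIV_isCont by (auto simp: continuous_on_eq_continuous_at)
  then obtain W where W: "\<And>x. (W has_real_derivative W1 x) (at x)"
    using antiderivative_real by blast
  define D where "D x = u x - W x" for x
  have "continuous_on UNIV W"
    using W DERIV_isCont by (auto simp: continuous_on_eq_continuous_at)
  then have "continuous_on UNIV D" unfolding D_def by (intro continuous_intros u)
  moreover have "2 * D (of_int q / 2^m) = D ((of_int q + 1) / 2^m) + D ((of_int q - 1) / 2^m)"
    if m: "1 \<le> m" for m and q :: int
  proof -
    define q0 where "q0 = nat (q mod 2^m)"
    define e where "e = q div 2^m"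
    have q0: "q0 < 2^m" unfolding q0_def by (simp add: nat_less_iff)
    have "int q0 = q mod 2^m" unfolding q0_def by simp
    then have "q = e * 2^m + int q0" by (simp only: e_def div_mult_mod_eq)
    then have q: "of_int q = real_of_int e * 2^m + real q0" by simp
    have s: "of_int q / 2^m = real q0 / 2^m + of_int e"
      "(of_int q + 1) / 2^m = (real q0 + 1) / 2^m + of_int e"
      "(of_int q - 1) / 2^m = (real q0 - 1) / 2^m + of_int e"
      unfolding q by (simp_all add: field_simps)
    have "2^m * (2 * u (real q0 / 2^m) - u ((real q0 + 1) / 2^m) - u ((real q0 - 1) / 2^m))
      = integral {0..1} (\<lambda>x. F x * hat m (x - real q0 / 2^m))"
      using weak[OF m q0] grid_form_hat[OF m q0, of u] u by simp
    also have "\<dots> = integral {0..1} (\<lambda>x. F x * hat m (x - of_int q / 2^m))"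
    proof -
      have "hat m (x - of_int q / 2^m) = hat m (x - real q0 / 2^m)" for x
        using hat_add_int[of m "x - of_int q / 2^m" e] by (simp add: s)
      then show ?thesis by simp
    qed
    also have "\<dots> = 2^m * (2 * W (of_int q / 2^m) - W ((of_int q + 1) / 2^m) - W ((of_int q - 1) / 2^m))"
      unfolding integral_hat[OF F m W W1] by (simp add: add_divide_distrib diff_divide_distrib)
    finally have "2 * u (of_int q / 2^m) - u ((of_int q + 1) / 2^m) - u ((of_int q - 1) / 2^m)
      = 2 * W (of_int q / 2^m) - W ((of_int q + 1) / 2^m) - W ((of_int q - 1) / 2^m)"
      unfolding s periodic_int[of u, OF u(2)] by simp
    then show ?thesis unfolding D_def by simp
  qed
  ultimately have "D x = D 0 + x * (D 1 - D 0)" for x by (rule dyadic_affine)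
  then have eq: "u = (\<lambda>x. W x + (D 0 + x * (D 1 - D 0)))" unfolding D_def by (auto simp: fun_eq_iff algebra_simps)
  show ?thesis
  proof (rule that[of "\<lambda>x. W1 x + (D 1 - D 0)"])
    show "(u has_real_derivative W1 x + (D 1 - D 0)) (at x)" for x
      unfolding eq by (auto intro!: derivative_eq_intros W)
    show "((\<lambda>x. W1 x + (D 1 - D 0)) has_real_derivative - F x) (at x)" for x
      by (auto intro!: derivative_eq_intros W1)
  qed
qed

section \<open>The min-max problem\<close>

definition periodic_cont :: "(real \<Rightarrow> real) \<Rightarrow> bool" where
  "periodic_cont u \<longleftrightarrow> continuous_on UNIV u \<and> (\<forall>x. u (x + 1) = u x)"

definition moment :: "('n \<Rightarrow> real \<Rightarrow> real) \<Rightarrow> 'n \<Rightarrow> 'n \<Rightarrow> real" where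
  "moment u i j = integral {0..1} (\<lambda>x. (u i x)\<^sup>2 * (u j x)\<^sup>2)"

text \<open>
  For fixed profiles \<open>u\<close>, with \<open>a i\<close> in the place of \<open>\<integral> u\<^sub>i'\<^sup>2\<close> and \<open>M i j = b i j * \<integral> u\<^sub>i\<^sup>2 u\<^sub>j\<^sup>2\<close>,
  this is the value of the action \<open>1/2 \<Sum> \<integral> v\<^sub>i'\<^sup>2 - 1/4 \<Sum> \<integral> b i j * v\<^sub>i\<^sup>2 v\<^sub>j\<^sup>2\<close> at
  \<open>v\<^sub>i = sqrt (t i) * u\<^sub>i\<close>.
\<close>

definition fibre :: "('n \<Rightarrow> real) \<Rightarrow> ('n \<Rightarrow> 'n \<Rightarrow> real) \<Rightarrow> 'n set \<Rightarrow> ('n \<Rightarrow> real) \<Rightarrow> real" where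
  "fibre a M I t = (\<Sum>i\<in>I. a i * t i) / 2 - qf M I t / 4"

lemma periodic_contD:
  assumes "periodic_cont u"
  shows "continuous_on S u" "u (x + 1) = u x" "u (x + of_int k) = u x"
  using assms continuous_on_subset[of UNIV u S] periodic_int[of u x k]
  by (auto simp: periodic_cont_def)

lemma integral_pos:
  fixes f :: "real \<Rightarrow> real"
  assumes "continuous_on {0..1} f" "\<And>x. x \<in> {0..1} \<Longrightarrow> f x \<ge> 0" "x0 \<in> {0..1}" "f x0 > 0"
  shows "integral {0..1} f > 0"
proof -
  have "integral {0..1} f \<noteq> 0"
    using integral_eq_0_iff[of 0 1 f] assms by force
  moreover have "integral {0..1} f \<ge> 0"
    using assms by (intro integral_nonneg integrable_continuous_real) auto
  ultimately show ?thesis by simp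
qed

lemma fibre_scale: "fibre a M I (\<lambda>i. s * t i) = s * ((\<Sum>i\<in>I. a i * t i) / 2) - s\<^sup>2 * (qf M I t / 4)"
  unfolding fibre_def qf_scale by (simp add: sum_distrib_left mult_ac)

lemma tendsto_fibre:
  assumes "finite I" "\<And>i. i \<in> I \<Longrightarrow> ((\<lambda>k. a k i) \<longlongrightarrow> A i) F"
    "\<And>i j. i \<in> I \<Longrightarrow> j \<in> I \<Longrightarrow> ((\<lambda>k. M k i j) \<longlongrightarrow> N i j) F"
    "\<And>i. i \<in> I \<Longrightarrow> ((\<lambda>k. w k i) \<longlongrightarrow> v i) F"
  shows "((\<lambda>k. fibre (a k) (M k) I (w k)) \<longlongrightarrow> fibre A N I v) F"
  unfolding fibre_def by (intro tendsto_intros tendsto_qf assms) auto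

lemma moment_cont:
  assumes "periodic_cont (u i)" "periodic_cont (u j)"
  shows "(\<lambda>x. (u i x)\<^sup>2 * (u j x)\<^sup>2) integrable_on {0..1}"
  by (intro integrable_continuous_real continuous_intros periodic_contD assms)

lemma qf_moment:
  assumes "finite I" "\<And>i. i \<in> I \<Longrightarrow> periodic_cont (u i)"
  shows "qf (\<lambda>i j. b i j * moment u i j) I t = integral {0..1} (\<lambda>x. qf b I (\<lambda>i. t i * (u i x)\<^sup>2))"
proof -
  have "((\<lambda>x. \<Sum>i\<in>I. \<Sum>j\<in>I. b i j * t i * t j * ((u i x)\<^sup>2 * (u j x)\<^sup>2)) has_integral
     (\<Sum>i\<in>I. \<Sum>j\<in>I. b i j * t i * t j * moment u i j)) {0..1}"
    unfolding moment_def using assms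
    by (intro has_integral_sum has_integral_mult_right integrable_integral moment_cont) auto
  moreover have "(\<lambda>x. \<Sum>i\<in>I. \<Sum>j\<in>I. b i j * t i * t j * ((u i x)\<^sup>2 * (u j x)\<^sup>2))
    = (\<lambda>x. qf b I (\<lambda>i. t i * (u i x)\<^sup>2))"
    unfolding qf_def by (auto intro!: sum.cong simp: mult_ac)
  moreover have "(\<Sum>i\<in>I. \<Sum>j\<in>I. b i j * t i * t j * moment u i j) = qf (\<lambda>i j. b i j * moment u i j) I t"
    unfolding qf_def by (auto intro!: sum.cong simp: mult_ac)
  ultimately show ?thesis by (simp add: integral_unique)
qed

lemma moment_diag_nonzero:
  assumes "moment u i i \<noteq> 0"
  obtains x where "x \<in> {0..1}" "u i x \<noteq> 0"
proof -
  have "\<exists>x\<in>{0..1}. u i x \<noteq> 0"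
  proof (rule ccontr)
    assume "\<not> ?thesis"
    then have "moment u i i = integral {0..1} (\<lambda>x::real. 0)"
      unfolding moment_def by (intro Henstock_Kurzweil_Integration.integral_cong) auto
    then show False using assms by simp
  qed
  then show ?thesis using that by blast
qed

text \<open>
  A function with \<open>\<integral> u\<^sup>4 = 1\<close> is at most 1 in absolute value at some point, and by the Hoelder
  estimate it oscillates by at most \<open>sqrt K\<close>.
\<close>

lemma normalised_bound:
  assumes u: "periodic_cont (u i)" "moment u i i = 1" "energy_le (u i) K" and x: "x \<in> {0..1}"
  shows "\<bar>u i x\<bar> \<le> 1 + sqrt K"
proof -
  have cont: "continuous_on {0..1} (\<lambda>x. (u i x)\<^sup>2 * (u i x)\<^sup>2)"
    by (intro continuous_intros periodic_contD u)
  obtain y where y: "y \<in> {0..1}" "\<And>x. x \<in> {0..1} \<Longrightarrow> (u i y)\<^sup>2 * (u i y)\<^sup>2 \<le> (u i x)\<^sup>2 * (u i x)\<^sup>2"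
    using continuous_attains_inf[OF _ _ cont] by auto
  have "integral {0..1} (\<lambda>x::real. (u i y)\<^sup>2 * (u i y)\<^sup>2) \<le> moment u i i"
    unfolding moment_def by (intro integral_le integrable_const_ivl moment_cont u y)
  then have "((u i y)\<^sup>2)\<^sup>2 \<le> 1\<^sup>2" using u by (simp add: power2_eq_square)
  then have "(u i y)\<^sup>2 \<le> 1" by (rule power2_le_imp_le) simp
  then have "\<bar>u i y\<bar> \<le> 1" by (simp add: abs_square_le_1)
  have "(u i x - u i y)\<^sup>2 \<le> K * \<bar>x - y\<bar>"
    by (rule energy_holder[OF u(3) periodic_contD(1)[OF u(1)] y(1) x])
  also have "\<dots> \<le> K * 1" using x y energy_le_nonneg[OF u(3)] by (intro mult_left_mono) auto
  finally have "\<bar>u i x - u i y\<bar> \<le> sqrt K" by (simp add: real_le_rsqrt)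
  with \<open>\<bar>u i y\<bar> \<le> 1\<close> show ?thesis by simp
qed

lemma periodic_cont_hat: "periodic_cont (\<lambda>x. hat m (x - p))"
  unfolding periodic_cont_def using hat_add_int[of m "_ - p" 1]
  by (auto intro!: continuous_intros simp: algebra_simps)

text \<open>
  Peaks at distinct even multiples of \<open>1 / 2\<^sup>m\<close> are at least two half-widths apart modulo 1.
\<close>

lemma hat_disjoint:
  fixes e f :: nat
  assumes m: "1 \<le> m" and e: "2 * e < 2^m" "2 * f < 2^m" "e \<noteq> f"
  shows "hat m (x - real_of_int (2 * int e) / 2^m) * hat m (x - real_of_int (2 * int f) / 2^m) = 0"
proof (rule ccontr)
  assume "\<not> ?thesis"
  then have nz: "hat m (x - real_of_int (2 * int e) / 2^m) \<noteq> 0" "hat m (x - real_of_int (2 * int f) / 2^m) \<noteq> 0" by auto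
  have ex: "\<exists>a::int. \<bar>x - p - of_int a\<bar> < 1 / 2^m" if "hat m (x - p) \<noteq> 0" for p
  proof -
    obtain z where z: "z \<in> \<int>" "infdist (x - p) \<int> = dist (x - p) z"
      using infdist_attains_inf[of "\<int>::real set" "x - p"] closed_Ints Ints_0 by blast
    moreover have "2^m * infdist (x - p) \<int> < 1" using that unfolding hat_def by linarith
    ultimately have "\<bar>x - p - z\<bar> < 1 / 2^m" by (simp add: dist_real_def field_simps)
    then show ?thesis using z(1) by (auto elim: Ints_cases)
  qed
  obtain a c :: int where a: "\<bar>x - real_of_int (2 * int e) / 2^m - of_int a\<bar> < 1 / 2^m"
      "\<bar>x - real_of_int (2 * int f) / 2^m - of_int c\<bar> < 1 / 2^m"
    using ex[OF nz(1)] ex[OF nz(2)] by blast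
  define D where "D = int e - int f + 2^(m-1) * (a - c)"
  have p: "(2::real)^m = 2 * 2^(m-1)" using m by (simp flip: power_Suc)
  have "\<bar>real_of_int (2 * int e) / 2^m + of_int a - (real_of_int (2 * int f) / 2^m + of_int c)\<bar> < 2 / 2^m"
    using a by linarith
  moreover have "real_of_int (2 * int e) / 2^m + of_int a - (real_of_int (2 * int f) / 2^m + of_int c)
     = real_of_int D * (2 / 2^m)"
    unfolding D_def p by (simp add: field_simps)
  ultimately have "\<bar>real_of_int D\<bar> * (2 / 2^m) < 1 * (2 / 2^m)" by (simp add: abs_mult)
  then have "\<bar>real_of_int D\<bar> < 1" by (subst (asm) mult_less_cancel_right) simp
  then have "D = 0" by linarith
  then have "int e - int f = 2^(m-1) * (c - a)" unfolding D_def by (simp add: algebra_simps)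
  moreover have "(2::nat)^m = 2 * 2^(m-1)" using m by (simp flip: power_Suc)
  then have "e < 2^(m-1)" "f < 2^(m-1)" using e by simp_all
  then have "int e < int (2^(m-1))" "int f < int (2^(m-1))" by (simp_all only: of_nat_less_iff)
  then have "int e < 2^(m-1)" "int f < 2^(m-1)" by (simp_all only: of_nat_power of_nat_numeral)
  then have "int e mod 2^(m-1) = int e" "int f mod 2^(m-1) = int f"
    by (intro mod_pos_pos_trivial; simp)+
  moreover have "int e mod 2^(m-1) = int f mod 2^(m-1)" if "int e - int f = 2^(m-1) * (c - a)"
    unfolding mod_eq_dvd_iff that by (rule dvd_triv_left)
  ultimately show False using e by simp
qed

context critical_matrix
begin

abbreviation interaction :: "('n \<Rightarrow> real \<Rightarrow> real) \<Rightarrow> 'n \<Rightarrow> 'n \<Rightarrow> real" where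
  "interaction u \<equiv> (\<lambda>i j. b i j * moment u i j)"

text \<open>
  The profile \<open>u\<close> keeps the action below \<open>\<gamma>\<close> on its whole fibre.  The number \<open>a i\<close> is only
  required to bound the energy from above, so that admissibility is a closed condition; the least possible
  \<open>\<gamma>\<close> is the min-max value.
\<close>

definition admissible :: "('n \<Rightarrow> real \<Rightarrow> real) \<Rightarrow> ('n \<Rightarrow> real) \<Rightarrow> real \<Rightarrow> bool" where
  "admissible u a \<gamma> \<longleftrightarrow>
     (\<forall>i\<in>I. periodic_cont (u i) \<and> moment u i i = 1 \<and> energy_le (u i) (a i)) \<and>
     (\<forall>t. (\<forall>i\<in>I. t i \<ge> 0) \<longrightarrow> fibre a (interaction u) I t \<le> \<gamma>)"

lemma admissibleD:
  assumes "admissible u a \<gamma>" "i \<in> I"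
  shows "periodic_cont (u i)" "moment u i i = 1" "energy_le (u i) (a i)" "a i \<ge> 0"
  using assms energy_le_nonneg by (auto simp: admissible_def)

lemma admissible_fibre:
  "admissible u a \<gamma> \<Longrightarrow> (\<And>i. i \<in> I \<Longrightarrow> t i \<ge> 0) \<Longrightarrow> fibre a (interaction u) I t \<le> \<gamma>"
  by (auto simp: admissible_def)

lemma admissible_nonneg: "admissible u a \<gamma> \<Longrightarrow> \<gamma> \<ge> 0"
  using admissible_fibre[of u a \<gamma> "\<lambda>_. 0"] by (simp add: fibre_def qf_def)

text \<open>
  Rescaling a component moves points along the fibre and leaves the maximum over it unchanged, so the
  normalisation \<open>\<integral> u\<^sub>i\<^sup>4 = 1\<close> costs nothing.
\<close>

lemma normalise:
  assumes v: "\<And>i. i \<in> I \<Longrightarrow> periodic_cont (v i)" "\<And>i. i \<in> I \<Longrightarrow> moment v i i > 0"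
    "\<And>i. i \<in> I \<Longrightarrow> energy_le (v i) (e i)"
    and bound: "\<And>t. (\<And>i. i \<in> I \<Longrightarrow> t i \<ge> 0) \<Longrightarrow> fibre e (interaction v) I t \<le> \<gamma>"
  shows "\<exists>u a. admissible u a \<gamma>"
proof -
  define s where "s i = 1 / root 4 (moment v i i)" for i
  define u where "u i x = s i * v i x" for i x
  have s: "s i ^ 4 * moment v i i = 1" if "i \<in> I" for i
    using v(2)[OF that] by (simp add: s_def power_divide)
  have mom: "moment u i j = (s i)\<^sup>2 * (s j)\<^sup>2 * moment v i j" for i j
    unfolding moment_def u_def integral_mult_right[symmetric] by (simp add: power_mult_distrib mult_ac)
  have "admissible u (\<lambda>i. (s i)\<^sup>2 * e i) \<gamma>"
    unfolding admissible_def
  proof (intro conjI ballI allI impI)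
    fix i assume i: "i \<in> I"
    show "periodic_cont (u i)"
      using v(1)[OF i] unfolding u_def periodic_cont_def by (auto intro!: continuous_intros)
    show "moment u i i = 1" using s[OF i] by (simp add: mom power2_eq_square power4_eq_xxxx)
    show "energy_le (u i) ((s i)\<^sup>2 * e i)" unfolding u_def by (intro energy_le_scale v i)
  next
    fix t :: "'n \<Rightarrow> real" assume t: "\<forall>i\<in>I. t i \<ge> 0"
    have "fibre (\<lambda>i. (s i)\<^sup>2 * e i) (interaction u) I t = fibre e (interaction v) I (\<lambda>i. (s i)\<^sup>2 * t i)"
      unfolding fibre_def qf_def mom by (simp add: mult_ac)
    also have "\<dots> \<le> \<gamma>" using t by (intro bound) auto
    finally show "fibre (\<lambda>i. (s i)\<^sup>2 * e i) (interaction u) I t \<le> \<gamma>" .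
  qed
  then show ?thesis by blast
qed

text \<open>
  If the components have disjoint supports, only the positive diagonal of \<open>b\<close> matters, and
  the action on the fibre is a sum of downward parabolas.
\<close>

lemma admissible_exists: "\<exists>u a \<gamma>. admissible u a \<gamma>"
proof -
  obtain en :: "'n \<Rightarrow> nat" where en: "inj_on en I"
    using finite_I by (metis finite_imp_inj_to_nat_seg)
  obtain m0 where m0: "\<And>i. i \<in> I \<Longrightarrow> 2 * en i < m0"
    using finite_nat_set_iff_bounded[of "(\<lambda>i. 2 * en i) ` I"] by auto
  define m where "m = Suc m0"
  have m: "1 \<le> m" "\<And>i. i \<in> I \<Longrightarrow> 2 * en i < 2^m"
  proof -
    show "2 * en i < 2^m" if "i \<in> I" for i
      using m0[OF that] less_exp[of m] unfolding m_def by linarith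
  qed (simp add: m_def)
  define v where "v i x = hat m (x - real_of_int (2 * int (en i)) / 2^m)" for i x
  have pc: "periodic_cont (v i)" for i
    unfolding v_def by (rule periodic_cont_hat)
  have "\<exists>K. energy_le (v i) K" for i
    unfolding v_def by (rule energy_le_hat[OF m(1)])
  then obtain e where e: "\<And>i. energy_le (v i) (e i)" by metis
  have off: "moment v i j = 0" if "i \<in> I" "j \<in> I" "i \<noteq> j" for i j
  proof -
    have "v i x * v j x = 0" for x
      unfolding v_def using that en m by (intro hat_disjoint) (auto simp: inj_on_def)
    then have "(\<lambda>x. (v i x)\<^sup>2 * (v j x)\<^sup>2) = (\<lambda>x. 0)" by (auto simp flip: power_mult_distrib)
    then show ?thesis unfolding moment_def by simp
  qed
  have diag: "moment v i i > 0" if i: "i \<in> I" for i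
    unfolding moment_def
  proof (rule integral_pos)
    show "continuous_on {0..1} (\<lambda>x. (v i x)\<^sup>2 * (v i x)\<^sup>2)" by (intro continuous_intros periodic_contD pc)
    have "real (2 * en i) \<le> real (2^m)" using m(2)[OF i] by (simp only: of_nat_le_iff)
    then show "real_of_int (2 * int (en i)) / 2^m \<in> {0..1}" by simp
    show "0 < (v i (real_of_int (2 * int (en i)) / 2 ^ m))\<^sup>2 * (v i (real_of_int (2 * int (en i)) / 2 ^ m))\<^sup>2"
      unfolding v_def by (simp add: hat_01)
  qed auto
  have "\<exists>u a. admissible u a (\<Sum>i\<in>I. (e i)\<^sup>2 / (4 * (b i i * moment v i i)))"
  proof (rule normalise[OF pc diag e])
    fix t :: "'n \<Rightarrow> real"
    have "qf (interaction v) I t = (\<Sum>i\<in>I. b i i * moment v i i * (t i)\<^sup>2)"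
      unfolding qf_def
    proof (rule sum.cong[OF refl])
      fix i assume i: "i \<in> I"
      have "(\<Sum>j\<in>I. b i j * moment v i j * t i * t j) = (\<Sum>j\<in>I. if j = i then b i i * moment v i i * (t i)\<^sup>2 else 0)"
        using off i by (intro sum.cong refl) (auto simp: power2_eq_square)
      then show "(\<Sum>j\<in>I. b i j * moment v i j * t i * t j) = b i i * moment v i i * (t i)\<^sup>2"
        using i by (simp add: sum.delta)
    qed
    then have "fibre e (interaction v) I t = (\<Sum>i\<in>I. e i * t i / 2 - b i i * moment v i i * (t i)\<^sup>2 / 4)"
      unfolding fibre_def by (simp add: sum_subtractf sum_divide_distrib)
    also have "\<dots> \<le> (\<Sum>i\<in>I. (e i)\<^sup>2 / (4 * (b i i * moment v i i)))"
    proof (rule sum_mono)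
      fix i assume i: "i \<in> I"
      define p where "p = b i i * moment v i i"
      have p: "p > 0" using diag[OF i] diag_pos[OF i] by (simp add: p_def)
      have "0 \<le> (e i - p * t i)\<^sup>2" by simp
      then show "e i * t i / 2 - b i i * moment v i i * (t i)\<^sup>2 / 4 \<le> (e i)\<^sup>2 / (4 * (b i i * moment v i i))"
        using p unfolding p_def[symmetric] by (simp add: field_simps power2_eq_square)
    qed
    finally show "fibre e (interaction v) I t \<le> (\<Sum>i\<in>I. (e i)\<^sup>2 / (4 * (b i i * moment v i i)))" .
  qed
  then show ?thesis by blast
qed

text \<open>
  Evaluate on the \<open>i\<close>-th axis, at the vertex of the parabola
  \<open>a i * t / 2 - b i i * t\<^sup>2 / 4\<close>.
\<close>

lemma admissible_energy_bound:
  assumes "admissible u a \<gamma>" "i \<in> I"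
  shows "(a i)\<^sup>2 \<le> 4 * b i i * \<gamma>"
proof -
  define t where "t k = (if k = i then a i / b i i else 0)" for k
  have b: "b i i > 0" using assms diag_pos by simp
  have "(\<Sum>k\<in>I. a k * t k) = a i * (a i / b i i)"
    using assms(2) unfolding t_def by (simp add: if_distrib[of "\<lambda>x. _ * x"] cong: if_cong)
  moreover have "qf (interaction u) I t = (a i / b i i)\<^sup>2 * b i i"
    unfolding t_def using qf_delta[OF finite_I assms(2), of "interaction u"] admissibleD[OF assms] by simp
  moreover have "fibre a (interaction u) I t \<le> \<gamma>"
    using assms b admissibleD[OF assms] by (intro admissible_fibre) (auto simp: t_def)
  ultimately have "a i * (a i / b i i) / 2 - (a i / b i i)\<^sup>2 * b i i / 4 \<le> \<gamma>"
    by (simp add: fibre_def)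
  then show ?thesis using b by (simp add: field_simps power2_eq_square)
qed

text \<open>
  Without energy all components would be constant of absolute value 1, and along the ray through
  \<open>c\<close> the action would be \<open>- s\<^sup>2 * qf b I c / 4\<close>, which is unbounded.  This is where the failure of
  copositivity forces the minimiser to be nonconstant.
\<close>

lemma positive_energy:
  assumes "admissible u a \<gamma>"
  shows "\<exists>i\<in>I. a i > 0"
proof (rule ccontr)
  assume "\<not> ?thesis"
  then have a: "a i = 0" if "i \<in> I" for i using admissibleD(4)[OF assms that] that by force
  have const: "u i x = u i 0" if i: "i \<in> I" and x: "x \<in> {0..1}" for i x
    using energy_holder[OF admissibleD(3)[OF assms i] periodic_contD(1)[OF admissibleD(1)[OF assms i]], of 0 x] a[OF i] x by simp
  have mom: "moment u i j = (u i 0)\<^sup>2 * (u j 0)\<^sup>2" if "i \<in> I" "j \<in> I" for i j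
  proof -
    have "moment u i j = integral {0..1} (\<lambda>x::real. (u i 0)\<^sup>2 * (u j 0)\<^sup>2)"
      unfolding moment_def
      by (rule Henstock_Kurzweil_Integration.integral_cong) (metis const that)
    then show ?thesis by simp
  qed
  have one: "(u i 0)\<^sup>2 = 1" if "i \<in> I" for i
  proof -
    have "((u i 0)\<^sup>2)\<^sup>2 = 1" using mom[OF that that] admissibleD(2)[OF assms that] by (simp add: power2_eq_square)
    then have "(u i 0)\<^sup>2 = 1 \<or> (u i 0)\<^sup>2 = - 1" by (simp only: power2_eq_1_iff)
    moreover have "(u i 0)\<^sup>2 \<ge> 0" by simp
    ultimately show ?thesis by linarith
  qed
  have "qf (interaction u) I t = qf b I t" for t
    unfolding qf_def by (intro sum.cong refl) (simp add: mom one)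
  then have f: "fibre a (interaction u) I (\<lambda>i. s * c i) = - (s\<^sup>2 * qf b I c) / 4" for s
    unfolding fibre_def qf_scale using a by simp
  define d where "d = - qf b I c"
  have d: "d > 0" "qf b I c = - d" using c_neg by (simp_all add: d_def)
  have "0 \<le> \<gamma>" by (rule admissible_nonneg[OF assms])
  then have pos: "0 \<le> 4 * (\<gamma> + 1) / d" using d by simp
  define s where "s = sqrt (4 * (\<gamma> + 1) / d)"
  have s: "s \<ge> 0" "s\<^sup>2 = 4 * (\<gamma> + 1) / d" using pos by (simp_all only: s_def real_sqrt_ge_zero real_sqrt_pow2)
  have "fibre a (interaction u) I (\<lambda>i. s * c i) = \<gamma> + 1"
    unfolding f d(2) s(2) using d(1) by simp
  moreover have "fibre a (interaction u) I (\<lambda>i. s * c i) \<le> \<gamma>"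
    using c_pos s(1) by (intro admissible_fibre[OF assms]) (simp add: less_imp_le)
  ultimately show False by simp
qed

text \<open>
  For a vector with entries of one strict sign, boundedness on the fibre decides: the linear term of the
  action along that ray is positive, so the quadratic term must be, too.  For all others
  \<open>mixed_sign_pos\<close> applies at each point \<open>x\<close> under the integral.
\<close>

lemma interaction_posdef:
  assumes adm: "admissible u a \<gamma>" and w: "\<exists>i\<in>I. w i \<noteq> 0"
  shows "qf (interaction u) I w > 0"
proof -
  have allpos: "qf (interaction u) I w > 0" if w: "\<And>i. i \<in> I \<Longrightarrow> w i > 0" for w
  proof (rule ccontr)
    assume "\<not> ?thesis"
    then have q: "qf (interaction u) I w \<le> 0" by simp
    obtain i0 where i0: "i0 \<in> I" "a i0 > 0" using positive_energy[OF adm] by blast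
    define A where "A = (\<Sum>i\<in>I. a i * w i) / 2"
    have "(\<Sum>i\<in>I. a i * w i) > 0"
    proof (rule sum_pos2[OF finite_I i0(1)])
      show "a i0 * w i0 > 0" using i0 w by simp
      show "a i * w i \<ge> 0" if "i \<in> I" for i
        using admissibleD(4)[OF adm that] less_imp_le[OF w[OF that]] by (rule mult_nonneg_nonneg)
    qed
    then have A: "A > 0" by (simp add: A_def)
    define s where "s = (\<gamma> + 1) / A"
    have s: "s \<ge> 0" "s * A = \<gamma> + 1" unfolding s_def using A admissible_nonneg[OF adm] by auto
    have "fibre a (interaction u) I (\<lambda>i. s * w i) \<le> \<gamma>"
      using s w by (intro admissible_fibre[OF adm]) (simp add: less_imp_le)
    moreover have "s\<^sup>2 * (qf (interaction u) I w / 4) \<le> 0"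
      using q by (intro mult_nonneg_nonpos) auto
    ultimately show False using s unfolding fibre_scale A_def[symmetric] by linarith
  qed
  consider "\<And>i. i \<in> I \<Longrightarrow> w i > 0" | "\<And>i. i \<in> I \<Longrightarrow> - w i > 0"
    | i j where "i \<in> I" "w i \<le> 0" "j \<in> I" "w j \<ge> 0"
  proof -
    assume *: "(\<And>i. i \<in> I \<Longrightarrow> w i > 0) \<Longrightarrow> thesis" "(\<And>i. i \<in> I \<Longrightarrow> - w i > 0) \<Longrightarrow> thesis"
      "\<And>i j. i \<in> I \<Longrightarrow> w i \<le> 0 \<Longrightarrow> j \<in> I \<Longrightarrow> w j \<ge> 0 \<Longrightarrow> thesis"
    show thesis
    proof (cases "(\<exists>i\<in>I. w i \<le> 0) \<and> (\<exists>j\<in>I. w j \<ge> 0)")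
      case True
      then show ?thesis using *(3) by blast
    next
      case False
      then consider "\<forall>i\<in>I. w i > 0" | "\<forall>i\<in>I. w i < 0" by force
      then show ?thesis using *(1,2) by cases auto
    qed
  qed
  then show ?thesis
  proof cases
    case 1
    then show ?thesis by (rule allpos)
  next
    case 2
    then show ?thesis using allpos[of "\<lambda>i. - w i"] by (simp add: qf_uminus)
  next
    case (3 i j)
    let ?f = "\<lambda>x. qf b I (\<lambda>i. w i * (u i x)\<^sup>2)"
    have pos: "?f x > 0" if "k \<in> I" "w k \<noteq> 0" "u k x \<noteq> 0" for k x
      by (rule mixed_sign_pos[of i _ j k]) (use that 3 in \<open>simp_all add: mult_nonpos_nonneg\<close>)
    have nonneg: "?f x \<ge> 0" for x
    proof (cases "\<exists>k\<in>I. w k \<noteq> 0 \<and> u k x \<noteq> 0")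
      case True
      then show ?thesis using pos less_imp_le by blast
    next
      case False
      then have "?f x = 0" by (intro qf_eq_0) auto
      then show ?thesis by simp
    qed
    obtain k where k: "k \<in> I" "w k \<noteq> 0" using w by blast
    obtain x0 where x0: "x0 \<in> {0..1}" "u k x0 \<noteq> 0"
      using moment_diag_nonzero[of u k] admissibleD(2)[OF adm k(1)] by auto
    have "integral {0..1} ?f > 0"
    proof (rule integral_pos[where ?x0.0=x0])
      show "?f x \<ge> 0" "?f x0 > 0" "x0 \<in> {0..1}" for x using nonneg pos[OF k x0(2)] x0(1) by auto
      show "continuous_on {0..1} ?f"
        unfolding qf_def by (intro continuous_intros periodic_contD admissibleD[OF adm])
    qed
    then show ?thesis by (subst qf_moment) (auto intro: admissibleD[OF adm])
  qed
qed

end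

section \<open>Compactness and existence of a minimiser\<close>

context critical_matrix
begin

text \<open>
  The energies are bounded along the sequence, so the components are uniformly bounded and equicontinuous on
  a period.  Limits of a subsequence exist uniformly by the Arzela-Ascoli theorem, and every
  condition in \<open>admissible\<close> is closed under them.
\<close>

lemma admissible_limit:
  assumes adm: "\<And>k. admissible (u k) (a k) (\<gamma> k)" and lim: "\<gamma> \<longlonglongrightarrow> \<gamma>0"
  shows "\<exists>U A. admissible U A \<gamma>0"
proof -
  obtain \<Gamma> where \<Gamma>: "\<And>k. \<gamma> k \<le> \<Gamma>"
    using Bseq_def[of \<gamma>] convergent_imp_Bseq[OF convergentI[OF lim]] by (metis abs_le_D1 real_norm_def)
  define K where "K = (\<Sum>i\<in>I. \<bar>sqrt (4 * b i i * \<Gamma>)\<bar>)"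
  have K0: "K \<ge> 0" unfolding K_def by (simp add: sum_nonneg)
  have aK: "a k i \<le> K" if i: "i \<in> I" for k i
  proof -
    have "(a k i)\<^sup>2 \<le> 4 * b i i * \<gamma> k" by (rule admissible_energy_bound[OF adm i])
    also have "\<dots> \<le> 4 * b i i * \<Gamma>" using \<Gamma> diag_pos[OF i] by (intro mult_left_mono) auto
    finally have "\<bar>a k i\<bar> \<le> sqrt (4 * b i i * \<Gamma>)" by (intro real_le_rsqrt) simp
    also have "\<dots> \<le> \<bar>sqrt (4 * b i i * \<Gamma>)\<bar>" by simp
    also have "\<dots> \<le> K" unfolding K_def using i by (intro member_le_sum) auto
    finally show ?thesis by simp
  qed
  have pc: "periodic_cont (u k i)" and mom: "moment (u k) i i = 1" and en: "energy_le (u k i) K"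
    and a0: "a k i \<ge> 0" if "i \<in> I" for k i
    using admissibleD[OF adm that] energy_le_mono[OF admissibleD(3)[OF adm that] aK[OF that]] by auto
  have bd01: "\<bar>u k i x\<bar> \<le> 1 + sqrt K" if "i \<in> I" "x \<in> {0..1}" for k i x
    by (rule normalised_bound[OF pc mom en that(2)]) (use that in auto)
  have red: "u k i x = u k i (frac x)" if "i \<in> I" for k i x
    using periodic_contD(3)[OF pc[OF that], of k "frac x" "\<lfloor>x\<rfloor>"] by (simp add: frac_def)
  have frac01: "frac x \<in> {0..1}" for x :: real using frac_lt_1[of x] by (simp add: less_imp_le)
  have bd: "\<bar>u k i x\<bar> \<le> 1 + sqrt K" if "i \<in> I" for k i x
    using bd01[OF that frac01] red[OF that] by simp
  let ?N = "real CARD('n)"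
  \<comment> \<open>components outside \<open>I\<close> are set to 0 to have vectors of a fixed type\<close>
  define \<alpha> :: "nat \<Rightarrow> real^'n" where "\<alpha> k = (\<chi> i. if i \<in> I then a k i else 0)" for k
  have "norm (\<alpha> k) \<le> ?N * K" for k
  proof -
    have "norm (\<alpha> k) \<le> (\<Sum>i\<in>UNIV. \<bar>\<alpha> k $ i\<bar>)" by (rule norm_le_l1_cart)
    also have "\<dots> \<le> (\<Sum>i::'n\<in>UNIV. K)" by (rule sum_mono) (auto simp: \<alpha>_def a0 aK K0)
    finally show ?thesis by simp
  qed
  then have "\<And>k. \<alpha> k \<in> cball 0 (?N * K)" by simp
  then obtain L r where r: "strict_mono r" "(\<alpha> \<circ> r) \<longlonglongrightarrow> L"
    using compact_cball[of "0::real^'n" "?N * K", unfolded compact_eq_seq_compact_metric seq_compact_def]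
    by blast
  define F :: "nat \<Rightarrow> real \<Rightarrow> real^'n" where "F k x = (\<chi> i. if i \<in> I then u (r k) i x else 0)" for k x
  have Fbd: "norm (F n x) \<le> ?N * (1 + sqrt K)" for n x
  proof -
    have "norm (F n x) \<le> (\<Sum>i\<in>UNIV. \<bar>F n x $ i\<bar>)" by (rule norm_le_l1_cart)
    also have "\<dots> \<le> (\<Sum>i::'n\<in>UNIV. 1 + sqrt K)" by (rule sum_mono) (auto simp: F_def bd K0)
    finally show ?thesis by simp
  qed
  have equi: "\<exists>d>0. \<forall>n y. y \<in> {0..1} \<and> norm (x - y) < d \<longrightarrow> norm (F n x - F n y) < e"
    if x: "x \<in> {0..1}" and e: "0 < e" for x e :: real
  proof -
    define \<eta> where "\<eta> = e / (?N + 1)"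
    have \<eta>: "\<eta> > 0" using e by (simp add: \<eta>_def)
    define d where "d = \<eta>\<^sup>2 / (K + 1)"
    have d: "d > 0" using \<eta> K0 by (simp add: d_def)
    have "norm (F n x - F n y) < e" if y: "y \<in> {0..1}" "norm (x - y) < d" for n y
    proof -
      have "norm (F n x - F n y) \<le> (\<Sum>i\<in>UNIV. \<bar>(F n x - F n y) $ i\<bar>)" by (rule norm_le_l1_cart)
      also have "\<dots> \<le> (\<Sum>i::'n\<in>UNIV. \<eta>)"
      proof (rule sum_mono)
        fix i :: 'n
        show "\<bar>(F n x - F n y) $ i\<bar> \<le> \<eta>"
        proof (cases "i \<in> I")
          case True
          have "(u (r n) i x - u (r n) i y)\<^sup>2 \<le> K * \<bar>x - y\<bar>"
            by (rule energy_holder[OF en[OF True] periodic_contD(1)[OF pc[OF True]] y(1) x])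
          also have "\<dots> \<le> (K + 1) * d" using y(2) K0 by (intro mult_mono) auto
          also have "\<dots> = \<eta>\<^sup>2" using K0 by (simp add: d_def)
          finally have "\<bar>u (r n) i x - u (r n) i y\<bar> \<le> \<eta>"
            using \<eta> by (metis abs_le_square_iff abs_of_pos)
          then show ?thesis using True by (simp add: F_def)
        next
          case False
          then show ?thesis using \<eta> by (simp add: F_def)
        qed
      qed
      also have "\<dots> = ?N * \<eta>" by simp
      also have "\<dots> < e" using e by (simp add: \<eta>_def field_simps)
      finally show ?thesis .
    qed
    then show ?thesis using d by blast
  qed
  obtain g s where g0: "continuous_on {0..1} g" "strict_mono (s :: nat \<Rightarrow> nat)"
    "\<And>e. 0 < e \<Longrightarrow> \<exists>N. \<forall>n x. n \<ge> N \<and> x \<in> {0..1} \<longrightarrow> norm (F (s n) x - g x) < e"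
    using Arzela_Ascoli[of "{0..1}" F, OF compact_Icc Fbd equi, of thesis] that by fast
  note g = g0(2,3)
  define \<rho> where "\<rho> = r \<circ> s"
  define U where "U i x = g (frac x) $ i" for i x
  define A where "A i = L $ i" for i
  have unif: "uniform_limit UNIV (\<lambda>n. u (\<rho> n) i) (U i) sequentially" if i: "i \<in> I" for i
  proof (rule uniform_limitI)
    fix e :: real assume "0 < e"
    then obtain N where N: "\<And>n x. n \<ge> N \<Longrightarrow> x \<in> {0..1} \<Longrightarrow> norm (F (s n) x - g x) < e" using g(2) by blast
    have "dist (u (\<rho> n) i x) (U i x) < e" if n: "n \<ge> N" for n x
    proof -
      have "dist (u (\<rho> n) i x) (U i x) = \<bar>(F (s n) (frac x) - g (frac x)) $ i\<bar>"
        using i by (simp add: dist_real_def red[OF i, of _ x] \<rho>_def F_def U_def)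
      also have "\<dots> \<le> norm (F (s n) (frac x) - g (frac x))" by (rule component_le_norm_cart)
      also have "\<dots> < e" by (rule N[OF n frac01])
      finally show ?thesis .
    qed
    then show "\<forall>\<^sub>F n in sequentially. \<forall>x\<in>UNIV. dist (u (\<rho> n) i x) (U i x) < e"
      unfolding eventually_sequentially by blast
  qed
  have ptw: "(\<lambda>n. u (\<rho> n) i x) \<longlonglongrightarrow> U i x" if "i \<in> I" for i x
    by (rule tendsto_uniform_limitI[OF unif[OF that]]) simp
  have Alim: "(\<lambda>n. a (\<rho> n) i) \<longlonglongrightarrow> A i" if "i \<in> I" for i
  proof -
    have "(\<lambda>n. ((\<alpha> \<circ> r) \<circ> s) n $ i) \<longlonglongrightarrow> L $ i"
      by (intro tendsto_vec_nth LIMSEQ_subseq_LIMSEQ[OF r(2) g(1)])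
    then show ?thesis using that by (simp add: \<alpha>_def \<rho>_def A_def)
  qed
  have pcU: "periodic_cont (U i)" if i: "i \<in> I" for i
    unfolding periodic_cont_def
  proof
    show "continuous_on UNIV (U i)"
      by (rule uniform_limit_theorem[OF _ unif[OF i]]) (auto intro: always_eventually periodic_contD pc i)
    show "\<forall>x. U i (x + 1) = U i x" by (simp add: U_def frac_def)
  qed
  have momlim: "(\<lambda>n. moment (u (\<rho> n)) i j) \<longlonglongrightarrow> moment U i j" if ij: "i \<in> I" "j \<in> I" for i j
    unfolding moment_def
  proof (rule dominated_convergence(2))
    show "(\<lambda>x. (u (\<rho> k) i x)\<^sup>2 * (u (\<rho> k) j x)\<^sup>2) integrable_on {0..1}" for k
      by (intro moment_cont pc ij)
    show "(\<lambda>x. (1 + sqrt K)\<^sup>2 * (1 + sqrt K)\<^sup>2) integrable_on {0..1::real}" by (rule integrable_const_ivl)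
    show "norm ((u (\<rho> k) i x)\<^sup>2 * (u (\<rho> k) j x)\<^sup>2) \<le> (1 + sqrt K)\<^sup>2 * (1 + sqrt K)\<^sup>2" for k x
    proof -
      have "\<bar>u (\<rho> k) i x\<bar>\<^sup>2 * \<bar>u (\<rho> k) j x\<bar>\<^sup>2 \<le> (1 + sqrt K)\<^sup>2 * (1 + sqrt K)\<^sup>2"
        by (intro mult_mono power_mono bd ij) auto
      then show ?thesis by simp
    qed
    show "(\<lambda>k. (u (\<rho> k) i x)\<^sup>2 * (u (\<rho> k) j x)\<^sup>2) \<longlonglongrightarrow> (U i x)\<^sup>2 * (U j x)\<^sup>2" for x
      by (intro tendsto_intros ptw ij)
  qed
  have "strict_mono \<rho>" unfolding \<rho>_def using r(1) g(1) by (rule strict_mono_o)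
  then have \<gamma>lim: "(\<lambda>n. \<gamma> (\<rho> n)) \<longlonglongrightarrow> \<gamma>0"
    using LIMSEQ_subseq_LIMSEQ[OF lim] by (simp add: o_def)
  have "admissible U A \<gamma>0"
    unfolding admissible_def
  proof (intro conjI ballI allI impI)
    fix i assume i: "i \<in> I"
    show "periodic_cont (U i)" by (rule pcU[OF i])
    show "moment U i i = 1" using momlim[OF i i] mom[OF i] by (simp add: LIMSEQ_const_iff)
    show "energy_le (U i) (A i)"
      by (rule energy_le_limit[OF ptw[OF i] Alim[OF i]]) (rule admissibleD(3)[OF adm i])
  next
    fix t :: "'n \<Rightarrow> real" assume t: "\<forall>i\<in>I. t i \<ge> 0"
    have "(\<lambda>n. fibre (a (\<rho> n)) (interaction (u (\<rho> n))) I t) \<longlonglongrightarrow> fibre A (interaction U) I t"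
      by (intro tendsto_fibre finite_I Alim tendsto_mult tendsto_const momlim)
    then show "fibre A (interaction U) I t \<le> \<gamma>0"
      by (rule LIMSEQ_le[OF _ \<gamma>lim]) (use admissible_fibre[OF adm] t in blast)
  qed
  then show ?thesis by blast
qed

text \<open>
  Passing to absolute values does not increase the energy and keeps all moments, so the minimiser can be
  taken nonnegative.
\<close>

lemma minimiser_exists:
  obtains u a \<gamma> where "admissible u a \<gamma>" "\<And>i x. u i x \<ge> 0"
    "\<And>u' a' \<gamma>'. admissible u' a' \<gamma>' \<Longrightarrow> \<gamma> \<le> \<gamma>'"
proof -
  define S where "S = {\<gamma>. \<exists>u a. admissible u a \<gamma>}"
  have ne: "S \<noteq> {}" using admissible_exists by (auto simp: S_def)
  have bdd: "bdd_below S" by (rule bdd_belowI[of _ 0]) (auto simp: S_def admissible_nonneg)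
  define \<gamma> where "\<gamma> = Inf S"
  have "\<exists>g\<in>S. g < \<gamma> + inverse (real (Suc k))" for k
    unfolding \<gamma>_def by (rule cInf_lessD[OF ne]) simp
  then obtain g where g: "\<And>k. g k \<in> S" "\<And>k. g k < \<gamma> + inverse (real (Suc k))" by metis
  then obtain u a where ua: "\<And>k. admissible (u k) (a k) (g k)" unfolding S_def by (simp) metis
  have "g \<longlonglongrightarrow> \<gamma>"
  proof (rule tendsto_sandwich[OF _ _ tendsto_const])
    show "\<forall>\<^sub>F k in sequentially. \<gamma> \<le> g k"
      unfolding \<gamma>_def using g(1) bdd by (intro always_eventually allI cInf_lower)
    show "\<forall>\<^sub>F k in sequentially. g k \<le> \<gamma> + inverse (real (Suc k))"
      using g(2) by (intro always_eventually allI less_imp_le)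
    show "(\<lambda>k. \<gamma> + inverse (real (Suc k))) \<longlonglongrightarrow> \<gamma>"
      using tendsto_add[OF tendsto_const LIMSEQ_inverse_real_of_nat, of \<gamma>] by simp
  qed
  from admissible_limit[OF ua this] obtain U A where UA: "admissible U A \<gamma>" by blast
  have "moment (\<lambda>i x. \<bar>U i x\<bar>) = moment U" by (intro ext) (simp add: moment_def)
  then have "admissible (\<lambda>i x. \<bar>U i x\<bar>) A \<gamma>"
    using UA unfolding admissible_def
    by (auto simp: periodic_cont_def intro!: continuous_intros energy_le_abs)
  moreover have "\<gamma> \<le> \<gamma>'" if "admissible u' a' \<gamma>'" for u' a' \<gamma>'
    unfolding \<gamma>_def using that bdd by (intro cInf_lower) (auto simp: S_def)
  ultimately show ?thesis using that[of "\<lambda>i x. \<bar>U i x\<bar>"] by simp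
qed

end

section \<open>Differentiating a maximum over the cone\<close>

lemma qf_perturb_le:
  assumes "finite I"
  shows "\<bar>qf E I t\<bar> \<le> (\<Sum>i\<in>I. \<Sum>j\<in>I. \<bar>E i j\<bar>) * (\<Sum>i\<in>I. (t i)\<^sup>2)"
proof -
  have tt: "\<bar>t i * t j\<bar> \<le> (\<Sum>i\<in>I. (t i)\<^sup>2)" if "i \<in> I" "j \<in> I" for i j
  proof -
    have "(t i)\<^sup>2 \<le> (\<Sum>i\<in>I. (t i)\<^sup>2)" "(t j)\<^sup>2 \<le> (\<Sum>i\<in>I. (t i)\<^sup>2)"
      using assms that by (auto intro!: member_le_sum)
    moreover have "2 * (\<bar>t i\<bar> * \<bar>t j\<bar>) \<le> (t i)\<^sup>2 + (t j)\<^sup>2"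
      using sum_squares_bound[of "\<bar>t i\<bar>" "\<bar>t j\<bar>"] by simp
    ultimately show ?thesis by (simp add: abs_mult)
  qed
  have "\<bar>qf E I t\<bar> \<le> (\<Sum>i\<in>I. \<Sum>j\<in>I. \<bar>E i j\<bar> * \<bar>t i * t j\<bar>)"
    unfolding qf_def by (intro order_trans[OF sum_abs] sum_mono) (simp add: abs_mult mult_ac)
  also have "\<dots> \<le> (\<Sum>i\<in>I. \<Sum>j\<in>I. \<bar>E i j\<bar> * (\<Sum>i\<in>I. (t i)\<^sup>2))"
    by (intro sum_mono mult_left_mono tt) auto
  finally show ?thesis by (simp add: sum_distrib_right)
qed

text \<open>
  Positive definiteness of the limit form survives small perturbations with half its coercivity
  constant, so points where the perturbed fibre functions are not too small stay bounded, and they have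
  a cluster point.
\<close>

lemma maximisers_converge:
  fixes M :: "'n::finite \<Rightarrow> 'n \<Rightarrow> real"
  assumes pd: "\<And>w. \<exists>i\<in>I. w i \<noteq> 0 \<Longrightarrow> qf M I w > 0"
    and A: "\<And>i. i \<in> I \<Longrightarrow> (\<lambda>k. A k i) \<longlonglongrightarrow> a i"
    and Mk: "\<And>i j. i \<in> I \<Longrightarrow> j \<in> I \<Longrightarrow> (\<lambda>k. Mk k i j) \<longlonglongrightarrow> M i j"
    and t: "\<And>k i. i \<in> I \<Longrightarrow> t k i \<ge> 0" "\<And>k. g k \<le> fibre (A k) (Mk k) I (t k)"
    and g: "g \<longlonglongrightarrow> \<gamma>"
  obtains r t0 where "strict_mono (r :: nat \<Rightarrow> nat)" "\<And>i. i \<in> I \<Longrightarrow> (\<lambda>k. t (r k) i) \<longlonglongrightarrow> t0 i"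
    "\<And>i. i \<in> I \<Longrightarrow> t0 i \<ge> 0" "\<gamma> \<le> fibre a M I t0"
proof -
  have fin [simp]: "finite I" by simp
  obtain \<kappa> where \<kappa>: "\<kappa> > 0" "\<And>w. \<kappa> * (\<Sum>i\<in>I. (w i)\<^sup>2) \<le> qf M I w"
    using posdef_coercive[OF pd] by blast
  define \<delta> where "\<delta> k = (\<Sum>i\<in>I. \<Sum>j\<in>I. \<bar>Mk k i j - M i j\<bar>)" for k
  define T where "T k = (\<Sum>i\<in>I. (t k i)\<^sup>2)" for k
  have T0: "T k \<ge> 0" for k unfolding T_def by (simp add: sum_nonneg)
  have "\<delta> \<longlonglongrightarrow> (\<Sum>i\<in>I. \<Sum>j\<in>I. \<bar>M i j - M i j\<bar>)"
    unfolding \<delta>_def by (intro tendsto_intros Mk)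
  then have d0: "\<delta> \<longlonglongrightarrow> 0" by simp
  define R where "R k = (\<Sum>i\<in>I. (A k i)\<^sup>2 / \<kappa>) - g k" for k
  define R0 where "R0 = (\<Sum>i\<in>I. (a i)\<^sup>2 / \<kappa>) - \<gamma>"
  have R: "R \<longlonglongrightarrow> R0"
    unfolding R_def R0_def using \<kappa> by (intro tendsto_intros A g) auto
  have bound: "T k \<le> 16 / \<kappa> * (R0 + 1)" if k: "\<delta> k < \<kappa> / 2" "R k < R0 + 1" for k
  proof -
    have "qf (Mk k) I (t k) = qf M I (t k) + qf (\<lambda>i j. Mk k i j - M i j) I (t k)"
      using qf_sub_matrix[of M 1 "\<lambda>i j. Mk k i j - M i j" I "t k"] by simp
    moreover have "\<bar>qf (\<lambda>i j. Mk k i j - M i j) I (t k)\<bar> \<le> \<delta> k * T k"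
      unfolding \<delta>_def T_def by (rule qf_perturb_le) simp
    moreover have "\<delta> k * T k \<le> \<kappa> / 2 * T k" using k T0 by (intro mult_right_mono) auto
    moreover have "\<kappa> * T k \<le> qf M I (t k)" unfolding T_def by (rule \<kappa>)
    ultimately have q: "\<kappa> / 2 * T k \<le> qf (Mk k) I (t k)" by linarith
    have "(\<Sum>i\<in>I. A k i * t k i) / 2 = (\<Sum>i\<in>I. A k i * t k i / 2)" by (simp add: sum_divide_distrib)
    also have "\<dots> \<le> (\<Sum>i\<in>I. (A k i)\<^sup>2 / \<kappa> + \<kappa> / 16 * (t k i)\<^sup>2)"
    proof (rule sum_mono)
      fix i
      have "0 \<le> (4 * A k i - \<kappa> * t k i)\<^sup>2" by simp
      then show "A k i * t k i / 2 \<le> (A k i)\<^sup>2 / \<kappa> + \<kappa> / 16 * (t k i)\<^sup>2"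
        using \<kappa>(1) by (simp add: field_simps power2_eq_square)
    qed
    also have "\<dots> = (\<Sum>i\<in>I. (A k i)\<^sup>2 / \<kappa>) + \<kappa> / 16 * T k"
      unfolding T_def by (simp add: sum.distrib sum_distrib_left)
    finally have "g k \<le> (\<Sum>i\<in>I. (A k i)\<^sup>2 / \<kappa>) + \<kappa> / 16 * T k - \<kappa> / 8 * T k"
      using t(2)[of k] q unfolding fibre_def by linarith
    then have "\<kappa> / 16 * T k \<le> R0 + 1" using k unfolding R_def by linarith
    then show ?thesis using \<kappa>(1) by (simp add: field_simps)
  qed
  have "\<forall>\<^sub>F k in sequentially. \<delta> k < \<kappa> / 2 \<and> R k < R0 + 1"
    using order_tendstoD(2)[OF d0, of "\<kappa> / 2"] order_tendstoD(2)[OF R, of "R0 + 1"] \<kappa>(1)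
    by (auto intro: eventually_conj)
  then obtain N where N: "\<And>k. k \<ge> N \<Longrightarrow> T k \<le> 16 / \<kappa> * (R0 + 1)"
    unfolding eventually_sequentially using bound by blast
  define \<tau> :: "nat \<Rightarrow> real^'n" where "\<tau> k = (\<chi> i. if i \<in> I then t (k + N) i else 0)" for k
  have "(norm (\<tau> k))\<^sup>2 = T (k + N)" for k
  proof -
    have "(norm (\<tau> k))\<^sup>2 = (\<Sum>i\<in>UNIV. (\<tau> k $ i)\<^sup>2)"
      by (simp add: norm_vec_def L2_set_def sum_nonneg)
    also have "\<dots> = (\<Sum>i\<in>I. (\<tau> k $ i)\<^sup>2)"
      by (intro sum.mono_neutral_right) (auto simp: \<tau>_def)
    also have "\<dots> = T (k + N)" unfolding T_def by (intro sum.cong) (auto simp: \<tau>_def)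
    finally show ?thesis .
  qed
  then have "norm (\<tau> k) \<le> sqrt (16 / \<kappa> * (R0 + 1))" for k
    using N[of "k + N"] by (intro real_le_rsqrt) simp
  then have "\<And>k. \<tau> k \<in> cball 0 (sqrt (16 / \<kappa> * (R0 + 1)))" by simp
  then obtain L r where r: "strict_mono r" "(\<tau> \<circ> r) \<longlonglongrightarrow> L"
    using compact_cball[of "0::real^'n" "sqrt (16 / \<kappa> * (R0 + 1))", unfolded compact_eq_seq_compact_metric seq_compact_def]
    by blast
  define r' where "r' k = r k + N" for k
  have r': "strict_mono r'" using r(1) unfolding r'_def strict_mono_def by simp
  have conv: "(\<lambda>k. t (r' k) i) \<longlonglongrightarrow> L $ i" if "i \<in> I" for i
  proof -
    have "(\<lambda>k. (\<tau> \<circ> r) k $ i) \<longlonglongrightarrow> L $ i" by (intro tendsto_vec_nth r(2))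
    then show ?thesis using that by (simp add: \<tau>_def r'_def)
  qed
  have sub: "(\<lambda>k. f (r' k)) \<longlonglongrightarrow> l" if "f \<longlonglongrightarrow> l" for f :: "nat \<Rightarrow> real" and l
    using LIMSEQ_subseq_LIMSEQ[OF that r'] by (simp add: o_def)
  have "(\<lambda>k. fibre (A (r' k)) (Mk (r' k)) I (t (r' k))) \<longlonglongrightarrow> fibre a M I (\<lambda>i. L $ i)"
    by (intro tendsto_fibre fin conv sub A Mk)
  then have "\<gamma> \<le> fibre a M I (\<lambda>i. L $ i)"
    by (rule LIMSEQ_le[OF sub[OF g]]) (use t(2) in blast)
  moreover have "L $ i \<ge> 0" if "i \<in> I" for i
    using conv[OF that] by (rule LIMSEQ_le_const) (use t(1) that in blast)
  ultimately show ?thesis using that[OF r' conv] by blast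
qed

text \<open>
  Strict concavity: at the midpoint of two maximisers the value would be larger.
\<close>

lemma maximiser_unique:
  assumes pd: "\<And>w. \<exists>i\<in>I. w i \<noteq> 0 \<Longrightarrow> qf M I w > 0"
    and bound: "\<And>t. (\<And>i. i \<in> I \<Longrightarrow> t i \<ge> 0) \<Longrightarrow> fibre a M I t \<le> \<gamma>"
    and t: "\<And>i. i \<in> I \<Longrightarrow> t i \<ge> 0" "\<gamma> \<le> fibre a M I t"
    and s: "\<And>i. i \<in> I \<Longrightarrow> s i \<ge> 0" "\<gamma> \<le> fibre a M I s"
    and i: "i \<in> I"
  shows "t i = s i"
proof (rule ccontr)
  assume "t i \<noteq> s i"
  then have pos: "qf M I (\<lambda>i. t i - s i) > 0" using i by (intro pd) auto
  have "qf M I (\<lambda>i. (t i + s i) / 2) = (\<Sum>i\<in>I. \<Sum>j\<in>I. M i j * t i * t j / 2 + M i j * s i * s j / 2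
       - M i j * (t i - s i) * (t j - s j) / 4)"
    unfolding qf_def by (intro sum.cong refl) (simp add: field_simps)
  also have "\<dots> = qf M I t / 2 + qf M I s / 2 - qf M I (\<lambda>i. t i - s i) / 4"
    unfolding qf_def by (simp only: sum.distrib sum_subtractf sum_divide_distrib)
  finally have q: "qf M I (\<lambda>i. (t i + s i) / 2) = qf M I t / 2 + qf M I s / 2 - qf M I (\<lambda>i. t i - s i) / 4" .
  have "(\<Sum>i\<in>I. a i * ((t i + s i) / 2)) = (\<Sum>i\<in>I. a i * t i) / 2 + (\<Sum>i\<in>I. a i * s i) / 2"
    unfolding sum_divide_distrib sum.distrib[symmetric] by (intro sum.cong refl) (simp add: field_simps)
  note lin = this
  have "fibre a M I (\<lambda>i. (t i + s i) / 2)
      = fibre a M I t / 2 + fibre a M I s / 2 + qf M I (\<lambda>i. t i - s i) / 16"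
    unfolding fibre_def q lin by (simp add: field_simps)
  moreover have "fibre a M I (\<lambda>i. (t i + s i) / 2) \<le> \<gamma>"
    using t(1) s(1) by (intro bound) (simp add: add_nonneg_nonneg)
  ultimately show False using pos t(2) s(2) by linarith
qed

lemma fibre_expand:
  "fibre (\<lambda>i. a i + e * \<alpha> i + e\<^sup>2 * \<beta> i) (\<lambda>i j. M i j + e * N i j + e\<^sup>2 * P i j) I t
    = fibre a M I t + e * fibre \<alpha> N I t + e\<^sup>2 * fibre \<beta> P I t"
  unfolding fibre_def qf_sub_matrix
  by (simp add: sum.distrib sum_distrib_left algebra_simps add_divide_distrib)

text \<open>
  The envelope argument of Danskin.  Let \<open>\<gamma>\<close> be the maximum of the fibre function over the cone for
  the data \<open>a, M\<close>, attained at \<open>s\<close>, and suppose that moving the data in the direction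
  \<open>\<alpha>, N\<close> does not decrease the maximum below \<open>\<gamma> - e\<^sup>2\<close>.  The near-maximisers of the perturbed
  data converge to the unique maximiser \<open>s\<close>, and comparing values at them to first order in \<open>e\<close>
  shows that the derivative of the data, evaluated at \<open>s\<close>, is nonnegative.
\<close>

lemma first_variation:
  fixes M :: "'n::finite \<Rightarrow> 'n \<Rightarrow> real"
  assumes pd: "\<And>w. \<exists>i\<in>I. w i \<noteq> 0 \<Longrightarrow> qf M I w > 0"
    and bound: "\<And>t. (\<And>i. i \<in> I \<Longrightarrow> t i \<ge> 0) \<Longrightarrow> fibre a M I t \<le> \<gamma>"
    and s: "\<And>i. i \<in> I \<Longrightarrow> s i \<ge> 0" "\<gamma> \<le> fibre a M I s"
    and e: "\<And>k. e k > 0" "e \<longlonglongrightarrow> 0"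
    and P: "\<And>i j. i \<in> I \<Longrightarrow> j \<in> I \<Longrightarrow> (\<lambda>k. P k i j) \<longlonglongrightarrow> P' i j"
    and near: "\<And>k. \<exists>t. (\<forall>i\<in>I. t i \<ge> 0) \<and> \<gamma> - (e k)\<^sup>2 \<le>
        fibre (\<lambda>i. a i + e k * \<alpha> i + (e k)\<^sup>2 * \<beta> i) (\<lambda>i j. M i j + e k * N i j + (e k)\<^sup>2 * P k i j) I t"
  shows "0 \<le> fibre \<alpha> N I s"
proof -
  have fin: "finite I" by simp
  define A' where "A' k i = a i + e k * \<alpha> i + (e k)\<^sup>2 * \<beta> i" for k i
  define M' where "M' k i j = M i j + e k * N i j + (e k)\<^sup>2 * P k i j" for k i j
  have "\<forall>k. \<exists>t. (\<forall>i\<in>I. t i \<ge> 0) \<and> \<gamma> - (e k)\<^sup>2 \<le> fibre (A' k) (M' k) I t"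
    using near unfolding A'_def M'_def by blast
  from choice[OF this] obtain t where t: "\<And>k i. i \<in> I \<Longrightarrow> t k i \<ge> 0"
    "\<And>k. \<gamma> - (e k)\<^sup>2 \<le> fibre (A' k) (M' k) I (t k)" by blast
  have Alim: "(\<lambda>k. A' k i) \<longlonglongrightarrow> a i" for i
  proof -
    have "(\<lambda>k. A' k i) \<longlonglongrightarrow> a i + 0 * \<alpha> i + 0\<^sup>2 * \<beta> i"
      unfolding A'_def by (intro tendsto_intros e(2))
    then show ?thesis by simp
  qed
  have Mlim: "(\<lambda>k. M' k i j) \<longlonglongrightarrow> M i j" if "i \<in> I" "j \<in> I" for i j
  proof -
    have "(\<lambda>k. M' k i j) \<longlonglongrightarrow> M i j + 0 * N i j + 0\<^sup>2 * P' i j"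
      unfolding M'_def by (intro tendsto_intros e(2) P that)
    then show ?thesis by simp
  qed
  have glim: "(\<lambda>k. \<gamma> - (e k)\<^sup>2) \<longlonglongrightarrow> \<gamma>"
    using tendsto_diff[OF tendsto_const tendsto_power[OF e(2), of 2]] by simp
  obtain r t0 where r: "strict_mono (r :: nat \<Rightarrow> nat)" "\<And>i. i \<in> I \<Longrightarrow> (\<lambda>k. t (r k) i) \<longlonglongrightarrow> t0 i"
    "\<And>i. i \<in> I \<Longrightarrow> t0 i \<ge> 0" "\<gamma> \<le> fibre a M I t0"
    by (rule maximisers_converge[where A=A' and Mk=M' and t=t and g="\<lambda>k. \<gamma> - (e k)\<^sup>2", OF pd Alim Mlim t glim])
      (assumption | rule that)+
  have t0: "t0 i = s i" if "i \<in> I" for i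
    by (rule maximiser_unique[where M=M and a=a and \<gamma>=\<gamma> and t=t0 and s=s, OF pd bound r(3,4) s that])
  have sub: "(\<lambda>k. f (r k)) \<longlonglongrightarrow> l" if "f \<longlonglongrightarrow> l" for f :: "nat \<Rightarrow> real" and l
    using LIMSEQ_subseq_LIMSEQ[OF that r(1)] by (simp add: o_def)
  have el: "(\<lambda>k. e (r k)) \<longlonglongrightarrow> 0" by (rule sub[OF e(2)])
  have Pl: "(\<lambda>k. P (r k) i j) \<longlonglongrightarrow> P' i j" if "i \<in> I" "j \<in> I" for i j
    by (rule sub[of "\<lambda>k. P k i j", OF P[OF that]])
  have fl: "(\<lambda>k. fibre \<beta> (P (r k)) I (t (r k))) \<longlonglongrightarrow> fibre \<beta> P' I t0"
    by (rule tendsto_fibre[OF fin tendsto_const Pl r(2)])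
  have "(\<lambda>k. - e (r k) * (1 + fibre \<beta> (P (r k)) I (t (r k)))) \<longlonglongrightarrow> - 0 * (1 + fibre \<beta> P' I t0)"
    by (intro tendsto_mult tendsto_add tendsto_minus tendsto_const el fl)
  then have l: "(\<lambda>k. - e (r k) * (1 + fibre \<beta> (P (r k)) I (t (r k)))) \<longlonglongrightarrow> 0" by simp
  have "(\<lambda>k. fibre \<alpha> N I (t (r k))) \<longlonglongrightarrow> fibre \<alpha> N I t0"
    by (rule tendsto_fibre[OF fin tendsto_const tendsto_const r(2)])
  then have "0 \<le> fibre \<alpha> N I t0"
  proof (rule LIMSEQ_le[OF l], intro exI allI impI)
    fix k
    let ?e = "e (r k)" and ?t = "t (r k)" and ?P = "P (r k)"
    have "\<gamma> - ?e\<^sup>2 \<le> \<gamma> + ?e * fibre \<alpha> N I ?t + ?e\<^sup>2 * fibre \<beta> ?P I ?t"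
    proof -
      have "fibre a M I ?t \<le> \<gamma>" by (rule bound[OF t(1)])
      then show ?thesis using t(2)[of "r k"] unfolding A'_def M'_def fibre_expand by linarith
    qed
    then have "?e * (- ?e * (1 + fibre \<beta> ?P I ?t)) \<le> ?e * fibre \<alpha> N I ?t"
      by (simp add: power2_eq_square algebra_simps)
    then show "- ?e * (1 + fibre \<beta> ?P I ?t) \<le> fibre \<alpha> N I ?t"
      using e(1)[of "r k"] by (subst (asm) mult_le_cancel_left_pos)
  qed
  also have "fibre \<alpha> N I t0 = fibre \<alpha> N I s"
    unfolding fibre_def using t0 qf_cong[of I t0 s N] by simp
  finally show ?thesis .
qed

text \<open>
  The moment is a polynomial of degree 4 in \<open>e\<close>; only its linear coefficient matters.
\<close>

lemma moment_perturb:
  assumes "periodic_cont (u i)" "periodic_cont (u j)" "periodic_cont (\<psi> i)" "periodic_cont (\<psi> j)"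
  shows "\<exists>c2 c3 c4. \<forall>e. moment (\<lambda>k x. u k x + e * \<psi> k x) i j = moment u i j
     + e * integral {0..1} (\<lambda>x. 2 * (u i x * \<psi> i x * (u j x)\<^sup>2) + 2 * (u j x * \<psi> j x * (u i x)\<^sup>2))
     + e\<^sup>2 * (c2 + e * c3 + e\<^sup>2 * c4)"
proof -
  let ?f1 = "\<lambda>x. 2 * (u i x * \<psi> i x * (u j x)\<^sup>2) + 2 * (u j x * \<psi> j x * (u i x)\<^sup>2)"
  let ?f2 = "\<lambda>x. (\<psi> i x)\<^sup>2 * (u j x)\<^sup>2 + 4 * (u i x * \<psi> i x * u j x * \<psi> j x) + (u i x)\<^sup>2 * (\<psi> j x)\<^sup>2"
  let ?f3 = "\<lambda>x. 2 * ((\<psi> i x)\<^sup>2 * u j x * \<psi> j x) + 2 * (u i x * \<psi> i x * (\<psi> j x)\<^sup>2)"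
  let ?f4 = "\<lambda>x. (\<psi> i x)\<^sup>2 * (\<psi> j x)\<^sup>2"
  have int: "?f1 integrable_on {0..1}" "?f2 integrable_on {0..1}" "?f3 integrable_on {0..1}" "?f4 integrable_on {0..1}"
    by (intro integrable_continuous_real continuous_intros periodic_contD assms)+
  have "moment (\<lambda>k x. u k x + e * \<psi> k x) i j = moment u i j + e * integral {0..1} ?f1
     + e\<^sup>2 * (integral {0..1} ?f2 + e * integral {0..1} ?f3 + e\<^sup>2 * integral {0..1} ?f4)" for e
  proof -
    have "((\<lambda>x. (u i x)\<^sup>2 * (u j x)\<^sup>2 + e * ?f1 x + e\<^sup>2 * (?f2 x + e * ?f3 x + e\<^sup>2 * ?f4 x)) has_integral
       (moment u i j + e * integral {0..1} ?f1
     + e\<^sup>2 * (integral {0..1} ?f2 + e * integral {0..1} ?f3 + e\<^sup>2 * integral {0..1} ?f4))) {0..1}"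
      unfolding moment_def
      by (intro has_integral_add has_integral_mult_right integrable_integral int moment_cont assms)
    moreover have "(\<lambda>x. (u i x)\<^sup>2 * (u j x)\<^sup>2 + e * ?f1 x + e\<^sup>2 * (?f2 x + e * ?f3 x + e\<^sup>2 * ?f4 x))
      = (\<lambda>x. (u i x + e * \<psi> i x)\<^sup>2 * (u j x + e * \<psi> j x)\<^sup>2)"
      by (intro ext) (simp add: power2_eq_square algebra_simps)
    ultimately show ?thesis unfolding moment_def[of "\<lambda>k x. u k x + e * \<psi> k x"] by (simp add: integral_unique)
  qed
  then show ?thesis by blast
qed

section \<open>The minimiser solves the one-dimensional system\<close>

context critical_matrix
begin

text \<open>
  By minimality of \<open>\<gamma>\<close> no profile keeps the action below a smaller value on its fibre, and by
  rescaling this extends to profiles that are not normalised.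
\<close>

lemma near_minimal:
  assumes min: "\<And>u' a' \<gamma>'. admissible u' a' \<gamma>' \<Longrightarrow> \<gamma> \<le> \<gamma>'"
    and v: "\<And>i. i \<in> I \<Longrightarrow> periodic_cont (v i)" "\<And>i. i \<in> I \<Longrightarrow> moment v i i > 0"
    "\<And>i. i \<in> I \<Longrightarrow> energy_le (v i) (e i)"
    and "\<gamma>' < \<gamma>"
  shows "\<exists>t. (\<forall>i\<in>I. t i \<ge> 0) \<and> \<gamma>' \<le> fibre e (interaction v) I t"
proof (rule ccontr)
  assume neg: "\<not> ?thesis"
  have "\<exists>u a. admissible u a \<gamma>'"
  proof (rule normalise[OF v])
    fix t :: "'n \<Rightarrow> real" assume "\<And>i. i \<in> I \<Longrightarrow> t i \<ge> 0"
    then have "\<not> \<gamma>' \<le> fibre e (interaction v) I t" using neg by blast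
    then show "fibre e (interaction v) I t \<le> \<gamma>'" by simp
  qed
  then show False using min \<open>\<gamma>' < \<gamma>\<close> by (meson not_le)
qed

text \<open>
  Perturb the \<open>i\<close>-th component by \<open>\<plusminus> e * \<phi>\<close>.  By \<open>first_variation\<close> the resulting derivative of the action
  at the maximiser \<open>s\<close> is nonnegative for both signs, so it vanishes: this is the
  equation \<open>- u\<^sub>i'' = \<Sum>\<^sub>k b i k * s k * u\<^sub>k\<^sup>2 * u\<^sub>i\<close> tested against \<open>\<phi>\<close>.
\<close>

lemma weak_equation:
  fixes q :: int
  assumes adm: "admissible u a \<gamma>"
    and min: "\<And>u' a' \<gamma>'. admissible u' a' \<gamma>' \<Longrightarrow> \<gamma> \<le> \<gamma>'"
    and s: "\<And>i. i \<in> I \<Longrightarrow> s i \<ge> 0" "\<gamma> \<le> fibre a (interaction u) I s"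
    and i: "i \<in> I" "s i > 0" and m: "1 \<le> m"
  defines "\<phi> \<equiv> (\<lambda>x. hat m (x - of_int q / 2^m))"
  shows "grid_form m (u i) \<phi> = (\<Sum>k\<in>I. b i k * s k * integral {0..1} (\<lambda>x. u i x * \<phi> x * (u k x)\<^sup>2))"
proof -
  define G where "G = grid_form m (u i) \<phi>"
  define H where "H = grid_form m \<phi> \<phi>"
  define X where "X k = integral {0..1} (\<lambda>x. u i x * \<phi> x * (u k x)\<^sup>2)" for k
  define S where "S = (\<Sum>k\<in>I. b i k * s k * X k)"
  have pc\<phi>: "periodic_cont \<phi>" unfolding \<phi>_def by (rule periodic_cont_hat)
  have pcu: "periodic_cont (u k)" if "k \<in> I" for k by (rule admissibleD(1)[OF adm that])
  have half: "0 \<le> \<sigma> * (s i * (G - S))" if \<sigma>: "\<sigma>\<^sup>2 = 1" for \<sigma> :: real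
  proof -
    define \<psi> where "\<psi> j x = (if j = i then \<sigma> * \<phi> x else 0)" for j x
    define v where "v \<epsilon> j x = u j x + \<epsilon> * \<psi> j x" for \<epsilon> j x
    define \<alpha> where "\<alpha> j = (if j = i then \<sigma> * (2 * G) else 0)" for j
    define \<beta> where "\<beta> j = (if j = i then H else 0)" for j
    define D where "D j k = integral {0..1} (\<lambda>x. 2 * (u j x * \<psi> j x * (u k x)\<^sup>2) + 2 * (u k x * \<psi> k x * (u j x)\<^sup>2))" for j k
    have pc\<psi>: "periodic_cont (\<psi> k)" for k
      using pc\<phi> unfolding periodic_cont_def \<psi>_def by (cases "k = i") (auto intro!: continuous_intros)
    have pcv: "periodic_cont (v \<epsilon> k)" if "k \<in> I" for k \<epsilon>
      using pc\<psi>[of k] pcu[OF that] unfolding periodic_cont_def v_def by (auto intro!: continuous_intros)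
    have env: "energy_le (v \<epsilon> j) (a j + \<epsilon> * \<alpha> j + \<epsilon>\<^sup>2 * \<beta> j)" if j: "j \<in> I" for j \<epsilon>
    proof (cases "j = i")
      case True
      have "energy_le (\<lambda>x. u i x + (\<epsilon> * \<sigma>) * \<phi> x) (a i + (\<epsilon> * \<sigma>) * (2 * G) + (\<epsilon> * \<sigma>)\<^sup>2 * H)"
        unfolding G_def H_def \<phi>_def by (rule energy_le_add_hat[OF admissibleD(3)[OF adm i(1)] m])
      moreover have "(\<lambda>x. u i x + (\<epsilon> * \<sigma>) * \<phi> x) = v \<epsilon> j" by (simp add: v_def \<psi>_def True mult_ac fun_eq_iff)
      moreover have "a i + (\<epsilon> * \<sigma>) * (2 * G) + (\<epsilon> * \<sigma>)\<^sup>2 * H = a j + \<epsilon> * \<alpha> j + \<epsilon>\<^sup>2 * \<beta> j"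
        using \<sigma> by (simp add: \<alpha>_def \<beta>_def True power_mult_distrib)
      ultimately show ?thesis by simp
    next
      case False
      then show ?thesis using admissibleD(3)[OF adm j] by (simp add: v_def[abs_def] \<psi>_def \<alpha>_def \<beta>_def)
    qed
    have "\<exists>p. \<forall>\<epsilon>. moment (v \<epsilon>) j k = moment u j k + \<epsilon> * D j k + \<epsilon>\<^sup>2 * (fst p + \<epsilon> * fst (snd p) + \<epsilon>\<^sup>2 * snd (snd p))"
      if jk: "j \<in> I" "k \<in> I" for j k
      using moment_perturb[OF pcu[OF jk(1)] pcu[OF jk(2)] pc\<psi> pc\<psi>] unfolding v_def D_def by force
    then have "\<forall>j k. \<exists>p. j \<in> I \<longrightarrow> k \<in> I \<longrightarrow> (\<forall>\<epsilon>. moment (v \<epsilon>) j k = moment u j k + \<epsilon> * D j k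
        + \<epsilon>\<^sup>2 * (fst p + \<epsilon> * fst (snd p) + \<epsilon>\<^sup>2 * snd (snd p)))" by blast
    then obtain p where p: "\<And>j k \<epsilon>. j \<in> I \<Longrightarrow> k \<in> I \<Longrightarrow> moment (v \<epsilon>) j k = moment u j k + \<epsilon> * D j k
        + \<epsilon>\<^sup>2 * (fst (p j k) + \<epsilon> * fst (snd (p j k)) + \<epsilon>\<^sup>2 * snd (snd (p j k)))" by metis
    define rem where "rem \<epsilon> j k = fst (p j k) + \<epsilon> * fst (snd (p j k)) + \<epsilon>\<^sup>2 * snd (snd (p j k))" for \<epsilon> j k
    have remlim: "(\<lambda>n. rem (f n) j k) \<longlonglongrightarrow> fst (p j k)" if "f \<longlonglongrightarrow> 0" for f :: "nat \<Rightarrow> real" and j k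
    proof -
      have "(\<lambda>n. rem (f n) j k) \<longlonglongrightarrow> fst (p j k) + 0 * fst (snd (p j k)) + 0\<^sup>2 * snd (snd (p j k))"
        unfolding rem_def by (intro tendsto_intros that)
      then show ?thesis by simp
    qed
    have e0: "(\<lambda>n. inverse (real (Suc n))) \<longlonglongrightarrow> 0" by (rule LIMSEQ_inverse_real_of_nat)
    have "\<forall>\<^sub>F n in sequentially. moment (v (inverse (real (Suc n)))) j j > 0" if j: "j \<in> I" for j
    proof -
      have "(\<lambda>n. moment u j j + inverse (real (Suc n)) * D j j + (inverse (real (Suc n)))\<^sup>2 * rem (inverse (real (Suc n))) j j)
        \<longlonglongrightarrow> moment u j j + 0 * D j j + 0\<^sup>2 * fst (p j j)"
        by (intro tendsto_add tendsto_mult tendsto_const tendsto_power e0 remlim[OF e0])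
      then have "(\<lambda>n. moment (v (inverse (real (Suc n)))) j j) \<longlonglongrightarrow> 1"
        using admissibleD(2)[OF adm j] unfolding p[OF j j] rem_def[symmetric] by simp
      then show ?thesis by (rule order_tendstoD) simp
    qed
    then have "\<forall>\<^sub>F n in sequentially. \<forall>j\<in>I. moment (v (inverse (real (Suc n)))) j j > 0"
      by (intro eventually_ball_finite finite_I) blast
    then obtain N where N: "\<And>n j. n \<ge> N \<Longrightarrow> j \<in> I \<Longrightarrow> moment (v (inverse (real (Suc n)))) j j > 0"
      unfolding eventually_sequentially by blast
    \<comment> \<open>the shift by \<open>N\<close> keeps the moments of the perturbed profiles positive\<close>
    define e where "e n = inverse (real (Suc (n + N)))" for n
    have e: "e n > 0" "e \<longlonglongrightarrow> 0" for n
      unfolding e_def using LIMSEQ_ignore_initial_segment[OF e0, of N] by simp_all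
    have "0 \<le> fibre \<alpha> (\<lambda>j k. b j k * D j k) I s"
    proof (rule first_variation[where M="interaction u" and a=a and \<gamma>=\<gamma> and e=e and \<beta>=\<beta>
          and P="\<lambda>n j k. b j k * rem (e n) j k" and P'="\<lambda>j k. b j k * fst (p j k)"])
      show "qf (interaction u) I w > 0" if "\<exists>i\<in>I. w i \<noteq> 0" for w by (rule interaction_posdef[OF adm that])
      show "fibre a (interaction u) I t \<le> \<gamma>" if "\<And>i. i \<in> I \<Longrightarrow> t i \<ge> 0" for t
        by (rule admissible_fibre[OF adm that])
      show "(\<lambda>n. b j k * rem (e n) j k) \<longlonglongrightarrow> b j k * fst (p j k)" for j k
        by (intro tendsto_mult tendsto_const remlim e)
      fix n
      have "\<exists>t. (\<forall>i\<in>I. t i \<ge> 0) \<and> \<gamma> - (e n)\<^sup>2 \<le> fibre (\<lambda>j. a j + e n * \<alpha> j + (e n)\<^sup>2 * \<beta> j) (interaction (v (e n))) I t"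
      proof (rule near_minimal[OF min pcv _ env])
        show "moment (v (e n)) j j > 0" if "j \<in> I" for j unfolding e_def by (rule N[OF _ that]) simp
        show "\<gamma> - (e n)\<^sup>2 < \<gamma>" using e(1)[of n] by simp
      qed
      moreover have "fibre (\<lambda>j. a j + e n * \<alpha> j + (e n)\<^sup>2 * \<beta> j) (interaction (v (e n))) I t
          = fibre (\<lambda>j. a j + e n * \<alpha> j + (e n)\<^sup>2 * \<beta> j)
             (\<lambda>j k. b j k * moment u j k + e n * (b j k * D j k) + (e n)\<^sup>2 * (b j k * rem (e n) j k)) I t" for t
        unfolding fibre_def qf_def
        by (intro arg_cong2[where f="(-)"] arg_cong2[where f="(/)"] sum.cong refl)
          (simp add: p rem_def algebra_simps)
      ultimately show "\<exists>t. (\<forall>i\<in>I. t i \<ge> 0) \<and> \<gamma> - (e n)\<^sup>2 \<le> fibre (\<lambda>j. a j + e n * \<alpha> j + (e n)\<^sup>2 * \<beta> j)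
             (\<lambda>j k. b j k * moment u j k + e n * (b j k * D j k) + (e n)\<^sup>2 * (b j k * rem (e n) j k)) I t"
        by simp
    qed (use s e in auto)
    also have "fibre \<alpha> (\<lambda>j k. b j k * D j k) I s = \<sigma> * (s i * (G - S))"
    proof -
      have D: "D j k = (if j = i then 2 * \<sigma> * X k else 0) + (if k = i then 2 * \<sigma> * X j else 0)"
        if jk: "j \<in> I" "k \<in> I" for j k
      proof -
        have int: "(\<lambda>x. u i x * \<phi> x * (u l x)\<^sup>2) integrable_on {0..1}" if "l \<in> I" for l
          by (intro integrable_continuous_real continuous_intros periodic_contD pcu pc\<phi> i that)
        have "((\<lambda>x. (if j = i then 2 * \<sigma> else 0) * (u i x * \<phi> x * (u k x)\<^sup>2)
                + (if k = i then 2 * \<sigma> else 0) * (u i x * \<phi> x * (u j x)\<^sup>2)) has_integral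
              ((if j = i then 2 * \<sigma> else 0) * X k + (if k = i then 2 * \<sigma> else 0) * X j)) {0..1}"
          unfolding X_def by (intro has_integral_add has_integral_mult_right integrable_integral int jk)
        moreover have "(\<lambda>x. (if j = i then 2 * \<sigma> else 0) * (u i x * \<phi> x * (u k x)\<^sup>2)
                + (if k = i then 2 * \<sigma> else 0) * (u i x * \<phi> x * (u j x)\<^sup>2))
            = (\<lambda>x. 2 * (u j x * \<psi> j x * (u k x)\<^sup>2) + 2 * (u k x * \<psi> k x * (u j x)\<^sup>2))"
          by (auto simp: \<psi>_def fun_eq_iff)
        ultimately have "D j k = (if j = i then 2 * \<sigma> else 0) * X k + (if k = i then 2 * \<sigma> else 0) * X j"
          unfolding D_def by (simp add: integral_unique)
        then show ?thesis by simp
      qed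
      have "qf (\<lambda>j k. b j k * D j k) I s = (\<Sum>j\<in>I. \<Sum>k\<in>I. (if j = i then 2 * \<sigma> * (b i k * s i * s k * X k) else 0)
          + (if k = i then 2 * \<sigma> * (b j i * s j * s i * X j) else 0))"
        unfolding qf_def by (intro sum.cong refl) (simp add: D algebra_simps)
      also have "\<dots> = (\<Sum>k\<in>I. 2 * \<sigma> * (b i k * s i * s k * X k))
          + (\<Sum>j\<in>I. 2 * \<sigma> * (b j i * s j * s i * X j))"
      proof -
        have "(\<Sum>j\<in>I. \<Sum>k\<in>I. (if j = i then f k else 0)) = (\<Sum>k\<in>I. f k)" for f :: "'n \<Rightarrow> real"
          using i(1) by (subst sum.swap) simp
        moreover have "(\<Sum>j\<in>I. \<Sum>k\<in>I. (if k = i then f j else 0)) = (\<Sum>j\<in>I. f j)" for f :: "'n \<Rightarrow> real"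
          using i(1) by simp
        ultimately show ?thesis by (simp only: sum.distrib)
      qed
      also have "\<dots> = 4 * \<sigma> * s i * S"
        unfolding S_def sum_distrib_left sum.distrib[symmetric]
        by (intro sum.cong refl) (simp add: sym[of _ i] mult_ac)
      finally have "qf (\<lambda>j k. b j k * D j k) I s = 4 * \<sigma> * s i * S" .
      moreover have "(\<Sum>j\<in>I. \<alpha> j * s j) = \<sigma> * (2 * G) * s i"
        using i(1) unfolding \<alpha>_def by (simp add: if_distrib[of "\<lambda>x. x * _"] sum.delta cong: if_cong)
      ultimately show ?thesis unfolding fibre_def by (simp add: algebra_simps)
    qed
    finally show ?thesis .
  qed
  from half[of 1] half[of "-1"] have "s i * (G - S) = 0" by simp
  then show ?thesis using i(2) unfolding G_def S_def X_def by simp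
qed

text \<open>
  The solution is \<open>V\<^sub>i = sqrt (s i) * u\<^sub>i\<close>, where \<open>u\<close> is the minimiser and \<open>s\<close> maximises the action on
  its fibre.  Components with \<open>s i = 0\<close> drop out, but \<open>s\<close> is not zero as the min-max value is
  positive.
\<close>

lemma line_solution:
  "\<exists>V V1. (\<forall>i x. V i x \<ge> 0) \<and> (\<exists>i x. V i x \<noteq> 0) \<and>
     (\<forall>i x. (V i has_real_derivative V1 i x) (at x)) \<and>
     (\<forall>i x. (V1 i has_real_derivative - (\<Sum>j\<in>UNIV. b i j * (V j x)\<^sup>2 * V i x)) (at x))"
proof -
  obtain u a \<gamma> where adm: "admissible u a \<gamma>" and u0: "\<And>i x. u i x \<ge> 0"
    and min: "\<And>u' a' \<gamma>'. admissible u' a' \<gamma>' \<Longrightarrow> \<gamma> \<le> \<gamma>'"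
    by (rule minimiser_exists) (rule that)
  have pcu: "periodic_cont (u k)" if "k \<in> I" for k by (rule admissibleD(1)[OF adm that])
  have "\<exists>t. (\<forall>i\<in>I. t i \<ge> 0) \<and> \<gamma> - inverse (real (Suc n)) \<le> fibre a (interaction u) I t" for n
    by (rule near_minimal[OF min]) (use admissibleD[OF adm] in auto)
  then have "\<forall>n. \<exists>t. (\<forall>i\<in>I. t i \<ge> 0) \<and> \<gamma> - inverse (real (Suc n)) \<le> fibre a (interaction u) I t" by blast
  from choice[OF this] obtain t where t: "\<And>n i. i \<in> I \<Longrightarrow> t n i \<ge> 0"
    "\<And>n. \<gamma> - inverse (real (Suc n)) \<le> fibre a (interaction u) I (t n)" by blast
  have glim: "(\<lambda>n. \<gamma> - inverse (real (Suc n))) \<longlonglongrightarrow> \<gamma>"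
    using tendsto_diff[OF tendsto_const LIMSEQ_inverse_real_of_nat, of \<gamma>] by simp
  obtain r s where s: "strict_mono (r :: nat \<Rightarrow> nat)" "\<And>i. i \<in> I \<Longrightarrow> (\<lambda>k. t (r k) i) \<longlonglongrightarrow> s i"
    "\<And>i. i \<in> I \<Longrightarrow> s i \<ge> 0" "\<gamma> \<le> fibre a (interaction u) I s"
    by (rule maximisers_converge[where A="\<lambda>_. a" and Mk="\<lambda>_. interaction u" and t=t
          and g="\<lambda>n. \<gamma> - inverse (real (Suc n))", OF interaction_posdef[OF adm] tendsto_const tendsto_const t glim])
      (assumption | rule that)+
  obtain i0 where i0: "i0 \<in> I" "a i0 > 0" using positive_energy[OF adm] by blast
  have "\<gamma> > 0"
    using admissible_energy_bound[OF adm i0(1)] diag_pos[OF i0(1)] i0(2)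
    by (smt (verit) mult_nonneg_nonpos zero_less_power)
  have "\<exists>i\<in>I. s i > 0"
  proof (rule ccontr)
    assume "\<not> ?thesis"
    then have "s i = 0" if "i \<in> I" for i using s(3)[OF that] that by force
    then have "fibre a (interaction u) I s = 0" unfolding fibre_def by (simp add: qf_eq_0)
    then show False using s(4) \<open>\<gamma> > 0\<close> by simp
  qed
  then obtain i1 where i1: "i1 \<in> I" "s i1 > 0" by blast
  define F where "F i x = (\<Sum>k\<in>I. b i k * s k * (u k x)\<^sup>2 * u i x)" for i x
  have "\<exists>w. \<forall>x. (u i has_real_derivative w x) (at x) \<and> (w has_real_derivative - F i x) (at x)"
    if i: "i \<in> I" "s i > 0" for i
  proof -
    have F: "periodic_cont (F i)"
      using pcu i(1) unfolding periodic_cont_def F_def by (auto intro!: continuous_intros)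
    obtain w where "\<And>x. (u i has_real_derivative w x) (at x)" "\<And>x. (w has_real_derivative - F i x) (at x)"
    proof (rule weak_solution_classical[of "u i" "F i"])
      fix m q :: nat assume m: "1 \<le> m"
      let ?\<phi> = "\<lambda>x. hat m (x - real q / 2^m)"
      have "grid_form m (u i) ?\<phi> = (\<Sum>k\<in>I. b i k * s k * integral {0..1} (\<lambda>x. u i x * ?\<phi> x * (u k x)\<^sup>2))"
        using weak_equation[OF adm min s(3,4) i m, where q="int q"] by simp
      also have "\<dots> = integral {0..1} (\<lambda>x. F i x * ?\<phi> x)"
      proof -
        have "((\<lambda>x. \<Sum>k\<in>I. b i k * s k * (u i x * ?\<phi> x * (u k x)\<^sup>2)) has_integral
            (\<Sum>k\<in>I. b i k * s k * integral {0..1} (\<lambda>x. u i x * ?\<phi> x * (u k x)\<^sup>2))) {0..1}"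
          by (intro has_integral_sum finite_I has_integral_mult_right integrable_integral
              integrable_continuous_real continuous_intros periodic_contD(1) pcu i)
        moreover have "(\<lambda>x. \<Sum>k\<in>I. b i k * s k * (u i x * ?\<phi> x * (u k x)\<^sup>2)) = (\<lambda>x. F i x * ?\<phi> x)"
          unfolding F_def sum_distrib_right by (intro ext sum.cong refl) (simp add: mult_ac)
        ultimately show ?thesis by (simp add: integral_unique)
      qed
      finally show "grid_form m (u i) ?\<phi> = integral {0..1} (\<lambda>x. F i x * ?\<phi> x)" .
    qed (use pcu[OF i(1)] F periodic_contD that in auto)
    then show ?thesis by blast
  qed
  then have "\<forall>i. \<exists>w. i \<in> I \<and> s i > 0 \<longrightarrow>
      (\<forall>x. (u i has_real_derivative w x) (at x) \<and> (w has_real_derivative - F i x) (at x))" by blast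
  from choice[OF this] obtain w where w: "\<And>i x. i \<in> I \<Longrightarrow> s i > 0 \<Longrightarrow> (u i has_real_derivative w i x) (at x)"
     "\<And>i x. i \<in> I \<Longrightarrow> s i > 0 \<Longrightarrow> (w i has_real_derivative - F i x) (at x)" by blast
  define \<rho> where "\<rho> i = (if i \<in> I then sqrt (s i) else 0)" for i
  define V where "V i x = \<rho> i * u i x" for i x
  define V1 where "V1 i x = (if \<rho> i = 0 then 0 else \<rho> i * w i x)" for i x
  have \<rho>: "\<rho> i \<ge> 0" "i \<in> I \<Longrightarrow> (\<rho> i)\<^sup>2 = s i" "\<rho> i \<noteq> 0 \<Longrightarrow> i \<in> I \<and> s i > 0" for i
    using s(3)[of i] unfolding \<rho>_def by (auto split: if_splits simp: less_le)
  have VF: "\<rho> i * F i x = (\<Sum>j\<in>UNIV. b i j * (V j x)\<^sup>2 * V i x)" for i x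
  proof -
    have "(\<Sum>j\<in>UNIV. b i j * (V j x)\<^sup>2 * V i x) = (\<Sum>j\<in>I. b i j * (V j x)\<^sup>2 * V i x)"
      by (rule sum.mono_neutral_right) (auto simp: V_def \<rho>_def)
    also have "\<dots> = (\<Sum>j\<in>I. b i j * s j * (u j x)\<^sup>2 * u i x * \<rho> i)"
      by (intro sum.cong refl) (simp add: V_def power_mult_distrib \<rho>(2))
    finally show ?thesis unfolding F_def sum_distrib_left by (simp add: mult_ac)
  qed
  have d1: "(V i has_real_derivative V1 i x) (at x)" for i x
  proof (cases "\<rho> i = 0")
    case True
    then show ?thesis unfolding V_def[abs_def] V1_def by simp
  next
    case False
    then have "((\<lambda>x. \<rho> i * u i x) has_real_derivative \<rho> i * w i x) (at x)"
      using \<rho>(3)[of i] by (intro DERIV_cmult w) auto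
    then show ?thesis using False unfolding V_def[abs_def] V1_def by simp
  qed
  have d2: "(V1 i has_real_derivative - (\<Sum>j\<in>UNIV. b i j * (V j x)\<^sup>2 * V i x)) (at x)" for i x
  proof (cases "\<rho> i = 0")
    case True
    then show ?thesis unfolding VF[symmetric] V1_def[abs_def] by simp
  next
    case False
    then have "((\<lambda>x. \<rho> i * w i x) has_real_derivative \<rho> i * - F i x) (at x)"
      using \<rho>(3)[of i] by (intro DERIV_cmult w) auto
    then show ?thesis using False unfolding VF[symmetric] V1_def[abs_def] by simp
  qed
  obtain x where "u i1 x \<noteq> 0" using moment_diag_nonzero[of u i1] admissibleD(2)[OF adm i1(1)] by auto
  then have "V i1 x \<noteq> 0" using i1 by (simp add: V_def \<rho>_def)
  moreover have "V i x \<ge> 0" for i x using \<rho>(1) u0 by (simp add: V_def)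
  ultimately show ?thesis using d1 d2 by blast
qed

end

section \<open>Reduction to one dimension and to a minimal face\<close>

text \<open>
  Functions of a single coordinate \<open>x $ k0\<close>: their Laplacian is the second derivative of the profile.
\<close>

lemma solution_of_line_solution:
  fixes B :: "real ^ 'n ^ 'n" and V :: "'n \<Rightarrow> real \<Rightarrow> real"
  assumes V0: "\<And>i x. V i x \<ge> 0" and ne: "\<exists>i x. V i x \<noteq> 0"
    and d1: "\<And>i x. (V i has_real_derivative V1 i x) (at x)"
    and d2: "\<And>i x. (V1 i has_real_derivative - (\<Sum>j\<in>UNIV. B $ i $ j * (V j x)\<^sup>2 * V i x)) (at x)"
  shows "\<exists>u :: 'n \<Rightarrow> real ^ 'd \<Rightarrow> real. is_solution B u \<and> nontrivial u"
proof -
  define k0 :: 'd where "k0 = undefined"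
  define u :: "'n \<Rightarrow> real ^ 'd \<Rightarrow> real" where "u i x = V i (x $ k0)" for i x
  define V2 where "V2 i x = - (\<Sum>j\<in>UNIV. B $ i $ j * (V j x)\<^sup>2 * V i x)" for i x
  have lift: "((\<lambda>x::real^'d. f (x $ k0)) has_derivative (\<lambda>h. f' * (h $ k0))) (at x)"
    if "(f has_real_derivative f') (at (x $ k0))" for f f' x
  proof -
    have "((\<lambda>x::real^'d. x $ k0) has_derivative (\<lambda>h. h $ k0)) (at x)"
      by (rule bounded_linear.has_derivative[OF bounded_linear_vec_nth has_derivative_ident])
    from has_derivative_compose[OF this that[unfolded has_field_derivative_def]] show ?thesis by simp
  qed
  have pd: "partial_deriv k (\<lambda>x::real^'d. f (x $ k0)) = (\<lambda>x. if k = k0 then f' (x $ k0) else 0)"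
    if "\<And>x. (f has_real_derivative f' x) (at x)" for f f' k
  proof
    fix x :: "real^'d"
    have "frechet_derivative (\<lambda>x::real^'d. f (x $ k0)) (at x) = (\<lambda>h. f' (x $ k0) * (h $ k0))"
      using frechet_derivative_at[OF lift[OF that]] by simp
    then show "partial_deriv k (\<lambda>x::real^'d. f (x $ k0)) x = (if k = k0 then f' (x $ k0) else 0)"
      unfolding partial_deriv_def by (simp add: axis_def)
  qed
  have p1: "partial_deriv k (u i) = (\<lambda>x. if k = k0 then V1 i (x $ k0) else 0)" for k i
    unfolding u_def[abs_def] by (rule pd[OF d1])
  have zero: "partial_deriv l (\<lambda>x::real^'d. 0) = (\<lambda>x. 0)" for l
    using pd[of "\<lambda>_. 0" "\<lambda>_. 0" l] by (simp cong: if_cong)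
  have p2: "partial_deriv l (partial_deriv k (u i)) = (\<lambda>x. if k = k0 \<and> l = k0 then V2 i (x $ k0) else 0)" for k l i
    using pd[of "V1 i" "V2 i" l] d2 zero[of l] unfolding p1 V2_def by (cases "k = k0") auto
  have cV: "continuous_on UNIV (V i)" for i
    using DERIV_isCont[OF d1] by (simp add: continuous_on_eq_continuous_at)
  have cV2: "continuous_on UNIV (\<lambda>x::real^'d. V2 i (x $ k0))" for i
  proof -
    have "continuous_on UNIV (\<lambda>x::real^'d. V j (x $ k0))" for j
      by (rule continuous_on_compose2[OF cV]) (auto intro: continuous_intros)
    then show ?thesis unfolding V2_def by (intro continuous_intros)
  qed
  have diff: "(\<lambda>x::real^'d. f (x $ k0)) differentiable_on UNIV"
    if "\<And>x. (f has_real_derivative f' x) (at x)" for f f'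
    using lift[OF that] unfolding differentiable_on_def differentiable_def by blast
  have "C2 (u i)" for i
    unfolding C2_def p2
  proof (intro conjI allI)
    show "u i differentiable_on UNIV" unfolding u_def[abs_def] by (rule diff[OF d1])
    show "partial_deriv k (u i) differentiable_on UNIV" for k
      unfolding p1 using diff[OF d2] by (cases "k = k0") auto
    show "continuous_on UNIV (\<lambda>x. if k = k0 \<and> l = k0 then V2 i (x $ k0) else 0)" for k l
      using cV2 by (cases "k = k0 \<and> l = k0") auto
  qed
  moreover have "laplacian (u i) x = V2 i (x $ k0)" for i x
    unfolding laplacian_def p2 by (simp add: sum.delta)
  ultimately have "is_solution B u"
    unfolding is_solution_def using V0 by (simp add: u_def V2_def)
  moreover have "nontrivial u"
  proof -
    obtain i y where "V i y \<noteq> 0" using ne by blast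
    then have "u i (\<chi> k. y) \<noteq> 0" by (simp add: u_def)
    then show ?thesis unfolding nontrivial_def by (intro exI[of _ i]) auto
  qed
  ultimately show ?thesis by blast
qed

text \<open>
  Take a smallest set \<open>I\<close> of indices whose face contains a nonzero point at which the form is not positive;
  all such points then lie in the interior of the face.  If the form is negative at one of them, the
  matrix is critical.  Otherwise \<open>c\<close> minimises the form over the face, the minimum is 0, and the
  gradient vanishes at the interior point \<open>c\<close>.
\<close>

lemma critical_matrix_or_null_vector:
  fixes b :: "'n::finite \<Rightarrow> 'n \<Rightarrow> real"
  assumes sym: "\<And>i j. b i j = b j i" and diag: "\<And>i. b i i \<ge> 0"
    and c: "\<And>i. c i \<ge> 0" "\<exists>i. c i \<noteq> 0" "qf b UNIV c \<le> 0"
  shows "(\<exists>I c. critical_matrix b I c) \<or>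
    (\<exists>c. (\<forall>i. c i \<ge> 0) \<and> (\<exists>i. c i \<noteq> 0) \<and> (\<forall>i. c i \<noteq> 0 \<longrightarrow> (\<Sum>j\<in>UNIV. b i j * c j) = 0))"
proof -
  define P where "P J \<longleftrightarrow> (\<exists>c. (\<forall>i. c i \<ge> 0) \<and> (\<exists>i. c i \<noteq> 0) \<and> (\<forall>i. i \<notin> J \<longrightarrow> c i = 0) \<and> qf b J c \<le> 0)" for J
  have "P UNIV" using c unfolding P_def by auto
  then obtain I where I: "P I" "\<And>J. P J \<Longrightarrow> card I \<le> card J"
    using ex_has_least_nat[of P UNIV card] by blast
  have face: "qf b I w > 0" if w: "\<And>i. i \<in> I \<Longrightarrow> w i \<ge> 0" "i \<in> I" "w i = 0" "j \<in> I" "w j \<noteq> 0" for w i j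
  proof (rule ccontr)
    assume neg: "\<not> ?thesis"
    define w' where "w' k = (if k \<in> I then w k else 0)" for k
    have "qf b I w = qf b (I - {i}) w'"
      unfolding qf_def using w(2,3)
      by (intro sum.mono_neutral_cong_right ballI) (auto simp: w'_def)
    then have "P (I - {i})"
      unfolding P_def using w neg by (intro exI[of _ w']) (auto simp: w'_def)
    moreover have "card (I - {i}) < card I" using w(2) by (intro psubset_card_mono) auto
    ultimately show False using I(2)[of "I - {i}"] by simp
  qed
  obtain c where c: "\<And>i. c i \<ge> 0" "\<exists>i. c i \<noteq> 0" "\<And>i. i \<notin> I \<Longrightarrow> c i = 0" "qf b I c \<le> 0"
    using I(1) unfolding P_def by blast
  have pos: "w i > 0" if w: "\<And>i. i \<in> I \<Longrightarrow> w i \<ge> 0" "j \<in> I" "w j \<noteq> 0" "qf b I w \<le> 0" "i \<in> I" for w i j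
  proof (rule ccontr)
    assume "\<not> w i > 0"
    then have "w i = 0" using w(1)[OF w(5)] by simp
    then have "qf b I w > 0" using face[of w i j] w by simp
    then show False using w(4) by simp
  qed
  obtain j0 where j0: "j0 \<in> I" "c j0 \<noteq> 0" using c(2,3) by blast
  have cpos: "c i > 0" if "i \<in> I" for i using pos[OF c(1) j0 c(4) that] .
  show ?thesis
  proof (cases "\<exists>w. (\<forall>i\<in>I. w i \<ge> 0) \<and> qf b I w < 0")
    case True
    then obtain w where w: "\<And>i. i \<in> I \<Longrightarrow> w i \<ge> 0" "qf b I w < 0" by blast
    then obtain j where j: "j \<in> I" "w j \<noteq> 0" using qf_eq_0[of I w b] by force
    have wpos: "w i > 0" if "i \<in> I" for i using pos[of w j i] w j that by simp
    have "b i i > 0" if i: "i \<in> I" for i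
    proof (cases "\<exists>k\<in>I. k \<noteq> i")
      case True
      then obtain k where k: "k \<in> I" "k \<noteq> i" by blast
      have "qf b I (\<lambda>k. if k = i then 1 else 0) > 0" by (rule face[OF _ k(1) _ i]) (use k in auto)
      then show ?thesis using qf_delta[of I i b 1] i by simp
    next
      case False
      then have "I = {i}" using i by blast
      then have "qf b I w = b i i * w i * w i" by (simp add: qf_def)
      moreover have "b i i * w i * w i \<ge> 0" using diag wpos[OF i] by simp
      ultimately show ?thesis using w(2) by simp
    qed
    note diag' = this
    have "critical_matrix b I w"
    proof
      show "b i j = b j i" for i j by (rule sym)
      show "\<And>w i j. (\<And>i. i \<in> I \<Longrightarrow> w i \<ge> 0) \<Longrightarrow> i \<in> I \<Longrightarrow> w i = 0 \<Longrightarrow> j \<in> I \<Longrightarrow> w j \<noteq> 0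
         \<Longrightarrow> qf b I w > 0" by (fact face)
      show "w i > 0" if "i \<in> I" for i using wpos[OF that] .
      show "b i i > 0" if "i \<in> I" for i using diag'[OF that] .
    qed (rule w(2))
    then show ?thesis by blast
  next
    case False
    then have nonneg: "qf b I w \<ge> 0" if "\<And>i. i \<in> I \<Longrightarrow> w i \<ge> 0" for w
    proof -
      have "\<not> qf b I w < 0" using False that by blast
      then show ?thesis by simp
    qed
    have q0: "qf b I c = 0" using nonneg[OF c(1)] c(4) by (rule order_antisym[rotated])
    have stat: "(\<Sum>j\<in>I. b i j * c j) = 0" if i: "i \<in> I" for i
    proof (rule ccontr)
      define g where "g = (\<Sum>j\<in>I. b i j * c j)"
      assume "\<not> ?thesis"
      then have g: "g \<noteq> 0" by (simp add: g_def)
      \<comment> \<open>a step against the gradient that stays in the cone and in the range where the linear term wins\<close>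
      define \<tau> where "\<tau> = min (c i / \<bar>g\<bar>) (1 / (b i i + 1))"
      have \<tau>: "\<tau> > 0" "\<tau> * \<bar>g\<bar> \<le> c i" "\<tau> * b i i < 2"
      proof -
        show "\<tau> > 0" unfolding \<tau>_def using cpos[OF i] g diag[of i] by (simp add: add_nonneg_pos)
        have "\<tau> * \<bar>g\<bar> \<le> c i / \<bar>g\<bar> * \<bar>g\<bar>" unfolding \<tau>_def by (intro mult_right_mono) auto
        then show "\<tau> * \<bar>g\<bar> \<le> c i" using g by simp
        have "\<tau> * b i i \<le> 1 / (b i i + 1) * b i i" unfolding \<tau>_def using diag by (intro mult_right_mono) auto
        also have "\<dots> \<le> 1" using diag[of i] by (simp add: divide_le_eq)
        finally show "\<tau> * b i i < 2" by simp
      qed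
      define w where "w k = (if k = i then - g else 0)" for k
      have "(\<Sum>k\<in>I. w k * (\<Sum>j\<in>I. b k j * c j)) = - g * g"
        using i unfolding w_def by (simp add: if_distrib[of "\<lambda>x. x * _"] sum.delta g_def cong: if_cong)
      moreover have "qf b I w = g\<^sup>2 * b i i"
        unfolding w_def using qf_delta[of I i b "-g"] i by simp
      ultimately have "qf b I (\<lambda>k. c k + \<tau> * w k) = - (\<tau> * g\<^sup>2) * (2 - \<tau> * b i i)"
        using qf_add[of b I c \<tau> w, OF sym] q0 by (simp add: power2_eq_square algebra_simps)
      also have "\<dots> < 0" using \<tau> g by (simp add: mult_neg_pos)
      finally have "qf b I (\<lambda>k. c k + \<tau> * w k) < 0" .
      moreover have "qf b I (\<lambda>k. c k + \<tau> * w k) \<ge> 0"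
      proof (rule nonneg)
        fix k
        have "\<tau> * g \<le> \<tau> * \<bar>g\<bar>" using \<tau>(1) by (intro mult_left_mono) auto
        then show "c k + \<tau> * w k \<ge> 0" using \<tau>(2) c(1)[of k] by (cases "k = i") (auto simp: w_def)
      qed
      ultimately show False by simp
    qed
    have "(\<Sum>j\<in>UNIV. b i j * c j) = (\<Sum>j\<in>I. b i j * c j)" for i
      by (rule sum.mono_neutral_right) (auto simp: c(3))
    then have "\<forall>i. c i \<noteq> 0 \<longrightarrow> (\<Sum>j\<in>UNIV. b i j * c j) = 0" using stat c(3) by auto
    then show ?thesis using c(1,2) by blast
  qed
qed

theorem theorem1p1:
  fixes B :: "real ^ 'n ^ 'n"
  assumes "CARD('d::finite) \<in> {1, 2, 3}"
    and "transpose B = B"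
    and "\<And>i. B $ i $ i \<ge> 0"
    and "\<not> strictly_copositive B"
  shows "\<exists>u :: 'n \<Rightarrow> real ^ 'd \<Rightarrow> real. is_solution B u \<and> nontrivial u"
proof -
  define b where "b i j = B $ i $ j" for i j
  have sym: "b i j = b j i" for i j
    using assms(2) unfolding b_def by (metis transpose_def vec_lambda_beta)
  obtain v where v: "v \<in> nonneg_cone" "v \<noteq> 0" "(\<Sum>i\<in>UNIV. \<Sum>j\<in>UNIV. B $ i $ j * v $ i * v $ j) \<le> 0"
    using assms(4) unfolding strictly_copositive_def by (auto simp: not_less)
  have c: "v $ i \<ge> 0" "\<exists>i. v $ i \<noteq> 0" "qf b UNIV (\<lambda>i. v $ i) \<le> 0" for i
    using v by (auto simp: nonneg_cone_def vec_eq_iff qf_def b_def)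
  from critical_matrix_or_null_vector[of b "\<lambda>i. v $ i", OF sym _ c] assms(3)
  consider I w where "critical_matrix b I w"
    | c where "\<And>i. c i \<ge> 0" "\<exists>i. c i \<noteq> 0" "\<And>i. c i \<noteq> 0 \<Longrightarrow> (\<Sum>j\<in>UNIV. b i j * c j) = 0"
    by (auto simp: b_def)
  then show ?thesis
  proof cases
    case 1
    from critical_matrix.line_solution[OF this] obtain V V1 where
      V: "\<And>i x. V i x \<ge> 0" "\<exists>i x. V i x \<noteq> 0" "\<And>i x. (V i has_real_derivative V1 i x) (at x)"
      "\<And>i x. (V1 i has_real_derivative - (\<Sum>j\<in>UNIV. B $ i $ j * (V j x)\<^sup>2 * V i x)) (at x)"
      unfolding b_def by blast
    show ?thesis by (rule solution_of_line_solution[OF V])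
  next
    case (2 c)
    have zero: "(\<Sum>j\<in>UNIV. B $ i $ j * (sqrt (c j))\<^sup>2 * sqrt (c i)) = 0" for i
      using 2(1,3) by (cases "c i = 0") (simp_all add: b_def flip: sum_distrib_right)
    show ?thesis
    proof (rule solution_of_line_solution[where V="\<lambda>i _. sqrt (c i)" and ?V1.0="\<lambda>i _. 0"])
      show "\<exists>i (x::real). sqrt (c i) \<noteq> 0" using 2(2) by simp
      show "((\<lambda>_. 0) has_real_derivative
          - (\<Sum>j\<in>UNIV. B $ i $ j * (sqrt (c j))\<^sup>2 * sqrt (c i))) (at x)" for i and x :: real
        unfolding zero by simp
    qed (use 2(1) in auto)
  qed
qed

end
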